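(* Let $0<a\leq b<+\infty$ and $\nu=\frac{1}{2}\delta_a+\frac{1}{2}\delta_b$. Let $E$ be the set of (unoriented, nearest-neighbour) edges of the lattice $\mathbb{Z}^2$, and let $\mu=\nu^{\otimes E}$, i.e. the resistances $(r_e)_{e\in E}$ are i.i.d. with law $\nu$. For $v\in\mathbb{Z}^2$ let $\mathcal{R}_r(0\leftrightarrow v)$ denote the effective resistance between $0$ and $v$. Then there is a constant $C>0$ such that for all $v$ with $|v|$ large enough, $$\operatorname{Var}_\mu\big(\mathcal{R}_r(0\leftrightarrow v)\big)\leq C(\log |v|)^{2/3},$$ where $|v|$ denotes the $\ell^1$-norm of $v$.
   Context: For each unoriented edge $e=\{x,y\}$ there are two oriented edges $\overrightarrow{xy},\overrightarrow{yx}$. A flow from a vertex $x_0$ to a vertex $y_0$ with strength $1$ is a function $\theta$ on oriented edges which is antisymmetric ($\theta(\overrightarrow{xy})=-\theta(\overrightarrow{yx})$), satisfies the node law $\sum_{y\sim x}\theta(\overrightarrow{xy})=0$ at every vertex $x\notin\{x_0,y_0\}$, and has net outflow $\sum_{y\sim x_0}\theta(\overrightarrow{x_0y})=1$ at $x_0$ (and net inflow $1$ at $y_0$). Since $\theta(e)^2$ does not depend on orientation it is defined for unoriented edges. Given positive resistances $r=(r_e)_{e\in E}$, the effective resistance is $\mathcal{R}_r(x_0\leftrightarrow y_0)=\inf_{\theta}\sum_{e\in E}r_e\theta(e)^2$, the infimum being over all flows $\theta$ from $x_0$ to $y_0$ of strength $1$. *)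

theory Defs
  imports "HOL-Probability.Probability"
begin

type_synonym vertex = "int \<times> int"

definition adj :: "vertex \<Rightarrow> vertex \<Rightarrow> bool" where
  "adj x y \<longleftrightarrow> \<bar>fst x - fst y\<bar> + \<bar>snd x - snd y\<bar> = 1"

definition Z2_edges :: "vertex set set" where
  "Z2_edges = {{x, y} | x y. adj x y}"

definition Z2_oriented :: "(vertex \<times> vertex) set" where
  "Z2_oriented = {(x, y). adj x y}"

definition l1norm :: "vertex \<Rightarrow> real" where
  "l1norm v = real_of_int (\<bar>fst v\<bar> + \<bar>snd v\<bar>)"

text \<open>A unit flow from x0 to y0: theta is a function on oriented edges (values on
  non-adjacent pairs are irrelevant).\<close>
definition unit_flow :: "vertex \<Rightarrow> vertex \<Rightarrow> (vertex \<Rightarrow> vertex \<Rightarrow> real) \<Rightarrow> bool" where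
  "unit_flow x0 y0 \<theta> \<longleftrightarrow>
     (\<forall>x y. adj x y \<longrightarrow> \<theta> x y = - \<theta> y x) \<and>
     (\<forall>x. x \<noteq> x0 \<and> x \<noteq> y0 \<longrightarrow> (\<Sum>y\<in>{y. adj x y}. \<theta> x y) = 0) \<and>
     (\<Sum>y\<in>{y. adj x0 y}. \<theta> x0 y) = 1 \<and>
     (\<Sum>y\<in>{y. adj y0 y}. \<theta> y y0) = 1"

text \<open>Energy sum_e r_e theta(e)^2 over unoriented edges, written as half the sum over
  oriented edges (theta(e)^2 does not depend on the orientation); valued in [0,\<infinity>].\<close>
definition energy :: "(vertex set \<Rightarrow> real) \<Rightarrow> (vertex \<Rightarrow> vertex \<Rightarrow> real) \<Rightarrow> ennreal" where
  "energy r \<theta> = (\<Sum>\<^sub>\<infinity>(x, y)\<in>Z2_oriented. ennreal (r {x, y} * (\<theta> x y)\<^sup>2)) / 2"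

text \<open>Effective resistance: infimum of energies over unit flows (real-valued; it is finite on Z^2).\<close>
definition eff_res :: "(vertex set \<Rightarrow> real) \<Rightarrow> vertex \<Rightarrow> vertex \<Rightarrow> real" where
  "eff_res r x0 y0 = enn2real (INF \<theta>\<in>{\<theta>. unit_flow x0 y0 \<theta>}. energy r \<theta>)"

definition nu :: "real \<Rightarrow> real \<Rightarrow> real measure" where
  "nu a b = measure_pmf (map_pmf (\<lambda>c. if c then a else b) (bernoulli_pmf (1/2)))"

definition env_law :: "real \<Rightarrow> real \<Rightarrow> (vertex set \<Rightarrow> real) measure" where
  "env_law a b = PiM Z2_edges (\<lambda>_. nu a b)"

definition variance_of :: "'a measure \<Rightarrow> ('a \<Rightarrow> real) \<Rightarrow> real" where
  "variance_of M X = integral\<^sup>L M (\<lambda>x. (X x - integral\<^sup>L M X)\<^sup>2)"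

end

theory Submission
  imports Defs "HOL-Analysis.Harmonic_Numbers"
begin

text \<open>Changing the resistance of one edge \<open>e\<close> changes the effective resistance by at most
  \<open>(b - a) \<theta>(e)\<^sup>2\<close>, where \<open>\<theta>\<close> is the unit current, so by the Efron--Stein inequality it suffices to bound
  \<open>\<Sum>\<theta>(e)^4\<close>, and this can be done for every environment with resistances in \<open>[a, b]\<close>.

  Let \<open>h\<close> be the potential of the current. The potential truncated to the levels \<open>[\<alpha>, \<beta>]\<close> has
  Dirichlet energy of order \<open>\<beta> - \<alpha>\<close>, because the current has strength one. For an edge \<open>xy\<close> with
  \<open>\<delta> = |h x - h y|\<close>, the maximum principle shows that the truncation to the levels between \<open>h x\<close> and \<open>h y\<close>
  oscillates by \<open>\<delta>\<close> on every square ring around \<open>x\<close> that does not surround a pole; the ring of radius \<open>s\<close>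
  then carries energy of order \<open>\<delta>\<^sup>2/s\<close> at least. Summing over \<open>s\<close> up to the distance \<open>S\<close> to
  the poles gives \<open>\<delta>\<^sup>2 ln S = O(\<delta>)\<close>, that is \<open>\<delta> = O(1 / ln S)\<close>. Conversely a function of Dirichlet
  energy \<open>Q\<close> satisfies \<open>(f x - f y)\<^sup>2 = O(Q ln |x - y|)\<close>, hence
  \<open>|h x - h y| = O(ln |x - y|)\<close>, and the current has energy \<open>O(ln K)\<close> in the ball of radius \<open>K\<close> around
  a pole and total energy \<open>O(ln |v|)\<close>. The choice \<open>ln K = (ln |v|)^(1/3)\<close> gives
  \<open>\<Sum>\<theta>(e)^4 = O(ln K + ln |v| / (ln K)\<^sup>2) = O((ln |v|)^(1/3))\<close>.\<close>

section \<open>Functions of finite Dirichlet energy\<close>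

definition sup_norm :: "vertex \<Rightarrow> int" where
  "sup_norm z = max \<bar>fst z\<bar> \<bar>snd z\<bar>"

lemma adj_commute: "adj x y \<longleftrightarrow> adj y x"
  by (auto simp: adj_def abs_minus_commute)

lemma adj_imp_neq: "adj x y \<Longrightarrow> x \<noteq> y"
  by (auto simp: adj_def)

lemma Z2_edgesI: "adj x y \<Longrightarrow> {x, y} \<in> Z2_edges"
  unfolding Z2_edges_def by blast

lemma neighbours_eq:
  "{y. adj x y} = {(fst x + 1, snd x), (fst x - 1, snd x), (fst x, snd x + 1), (fst x, snd x - 1)}"
  by (cases x) (auto simp: adj_def)

lemma finite_neighbours [simp, intro]: "finite {y. adj x y}"
  by (simp add: neighbours_eq)

text \<open>Bounding every finite partial sum expresses finite energy without a separate summability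
  hypothesis. A finite set may contain both orientations of an edge, so \<open>Q\<close> bounds
  twice the usual Dirichlet energy.\<close>

definition dirichlet_le :: "(vertex \<Rightarrow> real) \<Rightarrow> real \<Rightarrow> bool" where
  "dirichlet_le f Q \<longleftrightarrow>
     (\<forall>F. finite F \<longrightarrow> F \<subseteq> Z2_oriented \<longrightarrow> (\<Sum>(x, y)\<in>F. (f x - f y)\<^sup>2) \<le> Q)"

lemma dirichlet_le_nonneg: "dirichlet_le f Q \<Longrightarrow> 0 \<le> Q"
  unfolding dirichlet_le_def by (drule spec[of _ "{}"]) simp

lemma dirichlet_le_sum:
  assumes "dirichlet_le f Q" "finite I" "inj_on (\<lambda>i. (p i, q i)) I" "\<And>i. i \<in> I \<Longrightarrow> adj (p i) (q i)"
  shows "(\<Sum>i\<in>I. (f (p i) - f (q i))\<^sup>2) \<le> Q"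
proof -
  have "(\<Sum>i\<in>I. (f (p i) - f (q i))\<^sup>2) = (\<Sum>(x, y)\<in>(\<lambda>i. (p i, q i)) ` I. (f x - f y)\<^sup>2)"
    by (subst sum.reindex[OF assms(3)]) simp
  also have "\<dots> \<le> Q"
    using assms(1)[unfolded dirichlet_le_def, rule_format, of "(\<lambda>i. (p i, q i)) ` I"] assms(2,4)
    by (force simp: Z2_oriented_def)
  finally show ?thesis .
qed

lemma dirichlet_le_step:
  assumes "dirichlet_le f Q" "adj x y"
  shows "\<bar>f x - f y\<bar> \<le> sqrt Q"
  using dirichlet_le_sum[OF assms(1), of "{()}" "\<lambda>_. x" "\<lambda>_. y"] assms(2)
  by (auto intro!: real_le_rsqrt)

text \<open>Transports the bound along translations, reflections and rotations, so that it is enough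
  to study one side of a square and one quadrant.\<close>

lemma dirichlet_le_comp:
  assumes "dirichlet_le f Q" "inj \<sigma>" "\<And>x y. adj x y \<Longrightarrow> adj (\<sigma> x) (\<sigma> y)"
  shows "dirichlet_le (\<lambda>x. f (\<sigma> x)) Q"
  unfolding dirichlet_le_def
proof (intro allI impI)
  fix F assume F: "finite F" "F \<subseteq> Z2_oriented"
  have "inj_on (\<lambda>i. (\<sigma> (fst i), \<sigma> (snd i))) F"
    using assms(2) by (auto simp: inj_on_def)
  from dirichlet_le_sum[OF assms(1) F(1) this] F(2) assms(3)
  show "(\<Sum>(x, y)\<in>F. (f (\<sigma> x) - f (\<sigma> y))\<^sup>2) \<le> Q"
    by (force simp: case_prod_beta Z2_oriented_def)
qed

lemma abs_diff_le_sum_increments: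
  fixes g :: "int \<Rightarrow> real"
  assumes "i \<in> {l..u}" "j \<in> {l..u}"
  shows "\<bar>g i - g j\<bar> \<le> (\<Sum>k\<in>{l..<u}. \<bar>g k - g (k + 1)\<bar>)"
proof -
  have *: "\<bar>g i - g j\<bar> \<le> (\<Sum>k\<in>{i..<j}. \<bar>g k - g (k + 1)\<bar>)" if "i \<le> j" for i j
    using that
  proof (induction j rule: int_ge_induct)
    case (step j)
    then have "{i..<j + 1} = insert j {i..<j}" by auto
    with step show ?case by simp
  qed simp
  show ?thesis
  proof (cases "i \<le> j")
    case True
    have "(\<Sum>k\<in>{i..<j}. \<bar>g k - g (k + 1)\<bar>) \<le> (\<Sum>k\<in>{l..<u}. \<bar>g k - g (k + 1)\<bar>)"
      using assms by (intro sum_mono2) auto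
    with *[OF True] show ?thesis by linarith
  next
    case False
    have "(\<Sum>k\<in>{j..<i}. \<bar>g k - g (k + 1)\<bar>) \<le> (\<Sum>k\<in>{l..<u}. \<bar>g k - g (k + 1)\<bar>)"
      using assms by (intro sum_mono2) auto
    with *[of j i] False show ?thesis by linarith
  qed
qed

section \<open>Oscillation on concentric square rings\<close>

definition side_var :: "(vertex \<Rightarrow> real) \<Rightarrow> nat \<Rightarrow> real" where
  "side_var f s = (\<Sum>i\<in>{- int s..<int s}. \<bar>f (i, int s) - f (i + 1, int s)\<bar>)"

definition side_energy :: "(vertex \<Rightarrow> real) \<Rightarrow> nat \<Rightarrow> real" where
  "side_energy f s = (\<Sum>i\<in>{- int s..<int s}. (f (i, int s) - f (i + 1, int s))\<^sup>2)"

lemma side_var_square: "(side_var f s)\<^sup>2 \<le> 2 * real s * side_energy f s"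
proof -
  have "(side_var f s)\<^sup>2 \<le> real (card {- int s..<int s}) * side_energy f s"
    unfolding side_var_def side_energy_def
    using Cauchy_Schwarz_ineq_sum[of "\<lambda>_. 1" "\<lambda>i. \<bar>f (i, int s) - f (i + 1, int s)\<bar>" "{- int s..<int s}"]
    by simp
  then show ?thesis by simp
qed

lemma sum_side_energy:
  assumes "dirichlet_le f Q"
  shows "(\<Sum>s\<in>{1..S}. side_energy f s) \<le> Q"
proof -
  let ?I = "SIGMA s:{1..S}. {- int s..<int s}"
  have "(\<Sum>s\<in>{1..S}. side_energy f s) =
      (\<Sum>t\<in>?I. (f (snd t, int (fst t)) - f (snd t + 1, int (fst t)))\<^sup>2)"
    unfolding side_energy_def by (subst sum.Sigma) (auto simp: case_prod_beta)
  also have "\<dots> \<le> Q"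
    by (rule dirichlet_le_sum[OF assms]) (auto simp: inj_on_def adj_def)
  finally show ?thesis .
qed

lemma side_var_bound:
  "\<lbrakk>\<bar>i\<bar> \<le> int s; \<bar>j\<bar> \<le> int s\<rbrakk> \<Longrightarrow> \<bar>f (i, int s) - f (j, int s)\<bar> \<le> side_var f s"
  unfolding side_var_def by (rule abs_diff_le_sum_increments[where g = "\<lambda>i. f (i, int s)"]) auto

text \<open>A ring of radius \<open>s\<close> has \<open>8 * s\<close> edges, so by Cauchy-Schwarz
  an oscillation \<delta> costs energy of order \<open>\<delta>\<^sup>2 / s\<close> on it. Distinct
  rings have disjoint edges, and summing over the radii produces the harmonic number.\<close>

lemma ring_oscillation:
  fixes f :: "vertex \<Rightarrow> real"
  assumes Q: "dirichlet_le f Q"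
    and osc: "\<And>s. \<lbrakk>1 \<le> s; s \<le> S\<rbrakk> \<Longrightarrow>
      \<exists>z w. sup_norm z = int s \<and> sup_norm w = int s \<and> \<delta> \<le> \<bar>f z - f w\<bar>"
    and "0 \<le> \<delta>"
  shows "\<delta>\<^sup>2 * harm S \<le> 128 * Q"
proof -
  \<comment> \<open>\<open>side_var\<close> and \<open>side_energy\<close> see only the upper side
    of a ring; \<open>f2\<close>, \<open>f3\<close> and \<open>f4\<close> bring the lower, right and
    left sides there.\<close>
  define f2 where "f2 = (\<lambda>z. f (fst z, - snd z))"
  define f3 where "f3 = (\<lambda>z. f (snd z, fst z))"
  define f4 where "f4 = (\<lambda>z. f (- snd z, fst z))"
  have D: "dirichlet_le f2 Q" "dirichlet_le f3 Q" "dirichlet_le f4 Q"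
    unfolding f2_def f3_def f4_def
    by (rule dirichlet_le_comp[OF Q]; auto simp: inj_def adj_def)+
  define e where "e s = side_energy f s + side_energy f2 s + side_energy f3 s + side_energy f4 s" for s
  have bound: "\<delta>\<^sup>2 / real s \<le> 32 * e s" if s: "s \<in> {1..S}" for s
  proof -
    define T where "T = side_var f s + side_var f2 s + side_var f3 s + side_var f4 s"
    have nn: "0 \<le> side_var g s" for g by (auto simp: side_var_def intro: sum_nonneg)
    \<comment> \<open>Every vertex of the ring is joined to the upper right corner along at most two
      sides, each used once; hence any two vertices differ by at most \<open>2 * T\<close>.\<close>
    have corner: "\<bar>f z - f (int s, int s)\<bar> \<le> T" if zs: "sup_norm z = int s" for z
    proof -
      obtain i j where z: "z = (i, j)" by (cases z)
      have ij: "\<bar>i\<bar> \<le> int s" "\<bar>j\<bar> \<le> int s" using zs z by (auto simp: sup_norm_def)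
      consider "j = int s" | "j = - int s" | "i = int s" | "i = - int s"
        using zs z unfolding sup_norm_def by fastforce
      then show ?thesis
      proof cases
        case 1
        with side_var_bound[of i s "int s" f] ij nn[of f2] nn[of f3] nn[of f4] z
        show ?thesis by (simp add: T_def)
      next
        case 2
        with side_var_bound[of i s "int s" f2] side_var_bound[of "- int s" s "int s" f3]
          ij nn[of f] nn[of f4] z
        show ?thesis by (simp add: T_def f2_def f3_def)
      next
        case 3
        with side_var_bound[of j s "int s" f3] ij nn[of f2] nn[of f] nn[of f4] z
        show ?thesis by (simp add: T_def f3_def)
      next
        case 4
        with side_var_bound[of j s "int s" f4] side_var_bound[of "- int s" s "int s" f]
          ij nn[of f2] nn[of f3] z
        show ?thesis by (simp add: T_def f4_def)
      qed
    qed
    from osc[of s] s obtain z w where zw: "sup_norm z = int s" "sup_norm w = int s"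
      "\<delta> \<le> \<bar>f z - f w\<bar>" by auto
    have "\<delta> \<le> 2 * T"
      using corner[OF zw(1)] corner[OF zw(2)] zw(3) by linarith
    then have "\<delta>\<^sup>2 \<le> (2 * T)\<^sup>2"
      using \<open>0 \<le> \<delta>\<close> by (intro power_mono) auto
    also have "\<dots> \<le> 4 * (4 * ((side_var f s)\<^sup>2 + (side_var f2 s)\<^sup>2 + (side_var f3 s)\<^sup>2 + (side_var f4 s)\<^sup>2))"
    proof -
      have *: "(p + q + u + w)\<^sup>2 \<le> 4 * (p\<^sup>2 + q\<^sup>2 + u\<^sup>2 + w\<^sup>2)" for p q u w :: real
      proof -
        have "4 * (p\<^sup>2 + q\<^sup>2 + u\<^sup>2 + w\<^sup>2) - (p + q + u + w)\<^sup>2 =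
          (p-q)\<^sup>2 + (p-u)\<^sup>2 + (p-w)\<^sup>2 + (q-u)\<^sup>2 + (q-w)\<^sup>2 + (u-w)\<^sup>2"
          by (simp add: power2_eq_square algebra_simps)
        also have "\<dots> \<ge> 0" by simp
        finally show ?thesis by simp
      qed
      have "(2 * T)\<^sup>2 = 4 * T\<^sup>2" by (simp add: power2_eq_square)
      with *[of "side_var f s" "side_var f2 s" "side_var f3 s" "side_var f4 s"]
      show ?thesis unfolding T_def[symmetric] by linarith
    qed
    also have "\<dots> \<le> 4 * (4 * (2 * real s * e s))"
      using side_var_square[of f s] side_var_square[of f2 s] side_var_square[of f3 s]
        side_var_square[of f4 s] by (simp add: e_def algebra_simps)
    finally show ?thesis using s by (simp add: field_simps)
  qed
  have "\<delta>\<^sup>2 * harm S = (\<Sum>s\<in>{1..S}. \<delta>\<^sup>2 / real s)"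
    by (simp add: harm_def sum_distrib_left divide_inverse)
  also have "\<dots> \<le> (\<Sum>s\<in>{1..S}. 32 * e s)"
    by (intro sum_mono bound)
  also have "\<dots> \<le> 32 * (Q + Q + Q + Q)"
    unfolding sum_distrib_left[symmetric] e_def sum.distrib
    by (intro mult_left_mono add_mono sum_side_energy Q D) simp
  finally show ?thesis by simp
qed

section \<open>Logarithmic modulus of continuity from antidiagonal means\<close>

definition diag_mean :: "(vertex \<Rightarrow> real) \<Rightarrow> nat \<Rightarrow> real" where
  "diag_mean f k = (\<Sum>i\<le>k. f (int i, int (k - i))) / real (k + 1)"

definition diag_energy :: "(vertex \<Rightarrow> real) \<Rightarrow> nat \<Rightarrow> real" where
  "diag_energy f k = (\<Sum>i\<le>k. (f (int i, int (k - i)) - f (int i + 1, int (k - i)))\<^sup>2 +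
                            (f (int i, int (k - i)) - f (int i, int (k - i) + 1))\<^sup>2)"

text \<open>The weights \<open>(i + 1) / ((k + 1) (k + 2))\<close> are those of the flow of Polya's urn, which is
  uniform on every antidiagonal of the quadrant.\<close>

lemma diag_mean_step:
  "diag_mean f k - diag_mean f (Suc k) =
     (\<Sum>i\<le>k. real (i + 1) * (f (int i, int (k - i)) - f (int i + 1, int (k - i))) +
            real (k - i + 1) * (f (int i, int (k - i)) - f (int i, int (k - i) + 1)))
      / (real (k + 1) * real (k + 2))"
proof -
  define u where "u = (\<lambda>i. f (int i, int (k - i)))"
  define w where "w = (\<lambda>i. f (int i, int (Suc k - i)))"
  have "(\<Sum>i\<le>k. real (i + 1) * (f (int i, int (k - i)) - f (int i + 1, int (k - i))) +
            real (k - i + 1) * (f (int i, int (k - i)) - f (int i, int (k - i) + 1)))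
      = (\<Sum>i\<le>k. real (k + 2) * u i - real (Suc i) * w (Suc i) - real (Suc k - i) * w i)"
  proof (rule sum.cong)
    fix i assume "i \<in> {..k}"
    then have i: "i \<le> k" by simp
    have 1: "f (int i + 1, int (k - i)) = w (Suc i)" by (simp add: w_def algebra_simps)
    have 2: "f (int i, int (k - i) + 1) = w i" using i by (simp add: w_def of_nat_diff algebra_simps)
    show "real (i + 1) * (f (int i, int (k - i)) - f (int i + 1, int (k - i))) +
            real (k - i + 1) * (f (int i, int (k - i)) - f (int i, int (k - i) + 1))
      = real (k + 2) * u i - real (Suc i) * w (Suc i) - real (Suc k - i) * w i"
      unfolding 1 2 using i by (simp add: u_def of_nat_diff algebra_simps)
  qed simp
  also have "\<dots> = real (k + 2) * (\<Sum>i\<le>k. u i) -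
      ((\<Sum>i\<le>k. real (Suc i) * w (Suc i)) + (\<Sum>i\<le>k. real (Suc k - i) * w i))"
    by (simp add: sum_subtractf sum_distrib_left)
  \<comment> \<open>Vertex \<open>i\<close> of the next antidiagonal receives weight
    \<open>i\<close> from its left neighbour and \<open>Suc k - i\<close> from the one below, in
    total \<open>Suc k\<close> for every \<open>i\<close>. The missing weights at the two ends are
    0, so both sums may run up to \<open>Suc k\<close>.\<close>
  also have "(\<Sum>i\<le>k. real (Suc i) * w (Suc i)) = (\<Sum>i\<le>Suc k. real i * w i)"
    by (subst sum.atMost_Suc_shift) simp
  also have "(\<Sum>i\<le>k. real (Suc k - i) * w i) = (\<Sum>i\<le>Suc k. real (Suc k - i) * w i)"
    by simp
  also have "(\<Sum>i\<le>Suc k. real i * w i) + (\<Sum>i\<le>Suc k. real (Suc k - i) * w i) =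
      (\<Sum>i\<le>Suc k. real (Suc k) * w i)"
    unfolding sum.distrib[symmetric]
    by (rule sum.cong) (auto simp: of_nat_diff algebra_simps)
  also have "\<dots> = real (k + 1) * (\<Sum>i\<le>Suc k. w i)"
    by (simp only: sum_distrib_left Suc_eq_plus1)
  finally have "(\<Sum>i\<le>k. real (i + 1) * (f (int i, int (k - i)) - f (int i + 1, int (k - i))) +
            real (k - i + 1) * (f (int i, int (k - i)) - f (int i, int (k - i) + 1)))
     = real (k + 2) * (\<Sum>i\<le>k. u i) - real (k + 1) * (\<Sum>i\<le>Suc k. w i)" .
  moreover have "diag_mean f k = (\<Sum>i\<le>k. u i) / real (k + 1)"
    "diag_mean f (Suc k) = (\<Sum>i\<le>Suc k. w i) / real (k + 2)"
    by (simp_all add: diag_mean_def u_def w_def)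
  moreover have "P / real (k + 1) - R / real (k + 2) =
      (real (k + 2) * P - real (k + 1) * R) / (real (k + 1) * real (k + 2))" for P R
    by (simp add: field_simps)
  ultimately show ?thesis by simp
qed

text \<open>Every edge weight in the preceding identity is at most \<open>1 / (k + 1)\<close>, and
  Cauchy-Schwarz over the \<open>k + 1\<close> vertices of the antidiagonal gives back one factor
  \<open>k + 1\<close>.\<close>

lemma diag_mean_step_square:
  "(diag_mean f k - diag_mean f (Suc k))\<^sup>2 \<le> 2 / real (k + 1) * diag_energy f k"
proof -
  let ?p = "\<lambda>i. f (int i, int (k - i)) - f (int i + 1, int (k - i))"
  let ?q = "\<lambda>i. f (int i, int (k - i)) - f (int i, int (k - i) + 1)"
  have "\<bar>\<Sum>i\<le>k. real (i + 1) * ?p i + real (k - i + 1) * ?q i\<bar> \<le>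
     (\<Sum>i\<le>k. real (k + 2) * (\<bar>?p i\<bar> + \<bar>?q i\<bar>))"
  proof (rule order_trans[OF sum_abs sum_mono])
    fix i assume "i \<in> {..k}"
    then have "\<bar>real (i + 1) * ?p i\<bar> \<le> real (k + 2) * \<bar>?p i\<bar>"
      "\<bar>real (k - i + 1) * ?q i\<bar> \<le> real (k + 2) * \<bar>?q i\<bar>"
      unfolding abs_mult by (intro mult_right_mono; simp)+
    then show "\<bar>real (i + 1) * ?p i + real (k - i + 1) * ?q i\<bar> \<le> real (k + 2) * (\<bar>?p i\<bar> + \<bar>?q i\<bar>)"
      unfolding distrib_left by linarith
  qed
  also have "\<dots> = real (k + 2) * (\<Sum>i\<le>k. \<bar>?p i\<bar> + \<bar>?q i\<bar>)"
    by (simp add: sum_distrib_left)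
  finally have "\<bar>diag_mean f k - diag_mean f (Suc k)\<bar> \<le>
      real (k + 2) * (\<Sum>i\<le>k. \<bar>?p i\<bar> + \<bar>?q i\<bar>) / (real (k + 1) * real (k + 2))"
    unfolding diag_mean_step abs_divide by (intro frac_le) auto
  also have "\<dots> = (\<Sum>i\<le>k. \<bar>?p i\<bar> + \<bar>?q i\<bar>) / real (k + 1)"
    by simp
  finally have "(diag_mean f k - diag_mean f (Suc k))\<^sup>2 \<le> ((\<Sum>i\<le>k. \<bar>?p i\<bar> + \<bar>?q i\<bar>) / real (k + 1))\<^sup>2"
    by (subst power2_abs[symmetric], intro power_mono) simp_all
  also have "\<dots> = (\<Sum>i\<le>k. \<bar>?p i\<bar> + \<bar>?q i\<bar>)\<^sup>2 / (real (k + 1))\<^sup>2"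
    by (simp add: power_divide)
  also have "\<dots> \<le> (real (k + 1) * (2 * diag_energy f k)) / (real (k + 1))\<^sup>2"
  proof (intro divide_right_mono)
    have "(\<Sum>i\<le>k. \<bar>?p i\<bar> + \<bar>?q i\<bar>)\<^sup>2 \<le> real (k + 1) * (\<Sum>i\<le>k. (\<bar>?p i\<bar> + \<bar>?q i\<bar>)\<^sup>2)"
      using Cauchy_Schwarz_ineq_sum[of "\<lambda>_. 1" "\<lambda>i. \<bar>?p i\<bar> + \<bar>?q i\<bar>" "{..k}"] by simp
    also have "\<dots> \<le> real (k + 1) * (\<Sum>i\<le>k. 2 * ((?p i)\<^sup>2 + (?q i)\<^sup>2))"
    proof (intro mult_left_mono sum_mono)
      fix i show "(\<bar>?p i\<bar> + \<bar>?q i\<bar>)\<^sup>2 \<le> 2 * ((?p i)\<^sup>2 + (?q i)\<^sup>2)"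
        using sum_squares_bound[of "\<bar>?p i\<bar>" "\<bar>?q i\<bar>"] unfolding power2_sum by simp
    qed simp
    finally show "(\<Sum>i\<le>k. \<bar>?p i\<bar> + \<bar>?q i\<bar>)\<^sup>2 \<le> real (k + 1) * (2 * diag_energy f k)"
      by (simp add: diag_energy_def sum_distrib_left)
  qed simp
  also have "\<dots> = 2 / real (k + 1) * diag_energy f k"
    by (simp add: power2_eq_square)
  finally show ?thesis .
qed

lemma sum_diag_energy:
  assumes "dirichlet_le f Q"
  shows "(\<Sum>k<n. diag_energy f k) \<le> 2 * Q"
proof -
  let ?I = "SIGMA k:{..<n}. {..k}"
  have "(\<Sum>k<n. diag_energy f k) =
    (\<Sum>t\<in>?I. (f (int (snd t), int (fst t - snd t)) - f (int (snd t) + 1, int (fst t - snd t)))\<^sup>2) +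
    (\<Sum>t\<in>?I. (f (int (snd t), int (fst t - snd t)) - f (int (snd t), int (fst t - snd t) + 1))\<^sup>2)"
    unfolding diag_energy_def sum.distrib[symmetric] by (subst sum.Sigma) (auto simp: case_prod_beta)
  moreover have "(\<Sum>t\<in>?I. (f (int (snd t), int (fst t - snd t)) - f (int (snd t) + 1, int (fst t - snd t)))\<^sup>2) \<le> Q"
    by (rule dirichlet_le_sum[OF assms]) (auto simp: inj_on_def adj_def)
  moreover have "(\<Sum>t\<in>?I. (f (int (snd t), int (fst t - snd t)) - f (int (snd t), int (fst t - snd t) + 1))\<^sup>2) \<le> Q"
    by (rule dirichlet_le_sum[OF assms]) (auto simp: inj_on_def adj_def)
  ultimately show ?thesis by linarith
qed

text \<open>Telescoping over the antidiagonals, then Cauchy-Schwarz: the weights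
  \<open>2 / (k + 1)\<close> sum to \<open>2 * harm n\<close> and the antidiagonal energies to at
  most \<open>2 * Q\<close>.\<close>

lemma diag_mean_diff:
  assumes "dirichlet_le f Q"
  shows "\<bar>f (0, 0) - diag_mean f n\<bar> \<le> 2 * sqrt (harm n * Q)"
proof -
  have e: "0 \<le> diag_energy f k" for k by (auto simp: diag_energy_def intro!: sum_nonneg)
  have "\<bar>f (0, 0) - diag_mean f n\<bar> \<le> (\<Sum>k<n. \<bar>diag_mean f k - diag_mean f (Suc k)\<bar>)"
  proof (induction n)
    case 0 then show ?case by (simp add: diag_mean_def)
  next
    case (Suc n) then show ?case by simp
  qed
  also have "\<dots> \<le> (\<Sum>k<n. sqrt (2 / real (k + 1)) * sqrt (diag_energy f k))"
    using diag_mean_step_square[of f]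
    by (intro sum_mono) (simp add: real_le_rsqrt flip: real_sqrt_mult)
  also have "\<dots> \<le> sqrt ((\<Sum>k<n. 2 / real (k + 1)) * (\<Sum>k<n. diag_energy f k))"
    using Cauchy_Schwarz_ineq_sum[of "\<lambda>k. sqrt (2 / real (k + 1))" "\<lambda>k. sqrt (diag_energy f k)" "{..<n}"] e
    by (intro real_le_rsqrt) simp
  also have "(\<Sum>k<n. 2 / real (k + 1)) = 2 * harm n"
    unfolding harm_altdef sum_distrib_left by (simp add: divide_inverse)
  also have "sqrt (2 * harm n * (\<Sum>k<n. diag_energy f k)) \<le> sqrt (2 * harm n * (2 * Q))"
    using sum_diag_energy[OF assms, of n] by (intro real_sqrt_le_mono mult_left_mono) (auto simp: harm_nonneg)
  also have "\<dots> = sqrt (2\<^sup>2 * (harm n * Q))"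
    by (simp add: power2_eq_square algebra_simps)
  also have "\<dots> = 2 * sqrt (harm n * Q)"
    by (subst real_sqrt_mult) simp
  finally show ?thesis .
qed

text \<open>The quadrant at the origin and the reversed quadrant at \<open>(n, n)\<close> share the
  antidiagonal \<open>i + j = n\<close>, so both endpoints are compared with the same mean.\<close>

lemma diagonal_diff:
  assumes "dirichlet_le f Q"
  shows "\<bar>f (0, 0) - f (int n, int n)\<bar> \<le> 4 * sqrt (harm n * Q)"
proof -
  define g where "g = (\<lambda>z. f (int n - fst z, int n - snd z))"
  have "dirichlet_le g Q"
    unfolding g_def by (rule dirichlet_le_comp[OF assms]) (auto simp: inj_def adj_def)
  from diag_mean_diff[OF this, of n] diag_mean_diff[OF assms, of n]
  have "\<bar>f (0, 0) - diag_mean f n\<bar> \<le> 2 * sqrt (harm n * Q)"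
    "\<bar>f (int n, int n) - diag_mean g n\<bar> \<le> 2 * sqrt (harm n * Q)"
    by (simp_all add: g_def)
  moreover have "diag_mean g n = diag_mean f n"
  proof -
    have "(\<Sum>i\<le>n. f (int n - int i, int i)) = (\<Sum>i\<le>n. f (int i, int (n - i)))"
      by (rule sum.reindex_bij_witness[of _ "\<lambda>i. n - i" "\<lambda>i. n - i"]) (auto simp: of_nat_diff)
    then show ?thesis by (simp add: diag_mean_def g_def of_nat_diff)
  qed
  ultimately show ?thesis by simp
qed

lemma diagonal_diff_int:
  assumes "dirichlet_le f Q"
  shows "\<bar>f (i, j) - f (i + n, j + n)\<bar> \<le> 4 * sqrt (harm (nat \<bar>n\<bar>) * Q)"
    and "\<bar>f (i, j) - f (i + n, j - n)\<bar> \<le> 4 * sqrt (harm (nat \<bar>n\<bar>) * Q)"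
proof -
  define \<sigma> where "\<sigma> = (if n \<ge> 0 then 1 else - 1 :: int)"
  have \<sigma>: "n = \<sigma> * int (nat \<bar>n\<bar>)" "\<sigma> \<in> {1, - 1}" by (auto simp: \<sigma>_def)
  have "dirichlet_le (\<lambda>z. f (i + \<sigma> * fst z, j + \<sigma> * snd z)) Q"
    by (rule dirichlet_le_comp[OF assms]) (use \<sigma>(2) in \<open>auto simp: inj_def adj_def\<close>)
  from diagonal_diff[OF this, of "nat \<bar>n\<bar>"] \<sigma>(1)
  show "\<bar>f (i, j) - f (i + n, j + n)\<bar> \<le> 4 * sqrt (harm (nat \<bar>n\<bar>) * Q)" by simp
  have "dirichlet_le (\<lambda>z. f (i + \<sigma> * fst z, j - \<sigma> * snd z)) Q"
    by (rule dirichlet_le_comp[OF assms]) (use \<sigma>(2) in \<open>auto simp: inj_def adj_def\<close>)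
  from diagonal_diff[OF this, of "nat \<bar>n\<bar>"] \<sigma>(1)
  show "\<bar>f (i, j) - f (i + n, j - n)\<bar> \<le> 4 * sqrt (harm (nat \<bar>n\<bar>) * Q)" by simp
qed

lemma logarithmic_modulus:
  fixes f :: "vertex \<Rightarrow> real"
  assumes Q: "dirichlet_le f Q"
  shows "(f x - f y)\<^sup>2 \<le> 81 * (1 + harm (nat (sup_norm (y - x)))) * Q"
proof -
  obtain i j where x: "x = (i, j)" by (cases x)
  obtain k l where y: "y = (k, l)" by (cases y)
  define N where "N = nat (sup_norm (y - x))"
  \<comment> \<open>A diagonal segment of signed length \<open>n\<close> and an antidiagonal one of
    signed length \<open>m\<close> lead from \<open>x\<close> to \<open>w\<close>. Diagonal moves
    preserve the parity of the coordinate sum; the rounding in \<open>div\<close> accounts for this,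
    and \<open>w\<close> is \<open>y\<close> or its left neighbour.\<close>
  define n where "n = (k - i + (l - j)) div 2"
  define m where "m = n - (l - j)"
  define w where "w = (i + n + m, j + n - m)"
  have Q0: "0 \<le> Q" by (rule dirichlet_le_nonneg[OF Q])
  have bnd: "nat \<bar>n\<bar> \<le> N" "nat \<bar>m\<bar> \<le> N"
    unfolding N_def n_def m_def sup_norm_def x y by (auto simp: max_def)
  \<comment> \<open>The summand 1 pays for the possible last edge. The three pieces contribute
    \<open>4 + 4 + 1 = 9\<close>, whose square is the constant 81.\<close>
  define H where "H = sqrt ((1 + harm N) * Q)"
  have H: "sqrt (harm t * Q) \<le> H" if "t \<le> N" for t
    unfolding H_def using harm_mono[OF that, where 'a = real] Q0
    by (intro real_sqrt_le_mono mult_right_mono) auto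
  have "\<bar>f x - f (i + n, j + n)\<bar> \<le> 4 * H"
    using diagonal_diff_int(1)[OF Q, of i j n] H[OF bnd(1)] x by simp
  moreover have "\<bar>f (i + n, j + n) - f w\<bar> \<le> 4 * H"
    using diagonal_diff_int(2)[OF Q, of "i + n" "j + n" m] H[OF bnd(2)] w_def by simp
  moreover have "\<bar>f w - f y\<bar> \<le> H"
  proof (cases "w = y")
    case True
    then show ?thesis using Q0 harm_nonneg[of N, where 'a = real] by (simp add: H_def)
  next
    case False
    have "w = (k, l) \<or> w = (k - 1, l)"
      unfolding w_def n_def m_def by auto
    with False y have "adj w y" by (auto simp: adj_def)
    from dirichlet_le_step[OF Q this] have "\<bar>f w - f y\<bar> \<le> sqrt Q" .
    also have "\<dots> \<le> H"
      unfolding H_def using Q0 harm_nonneg[of N, where 'a = real]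
      by (intro real_sqrt_le_mono) (simp add: algebra_simps)
    finally show ?thesis .
  qed
  ultimately have "\<bar>f x - f y\<bar> \<le> 9 * H" by linarith
  then have "\<bar>f x - f y\<bar>\<^sup>2 \<le> (9 * H)\<^sup>2" by (intro power_mono) auto
  then show ?thesis
    using Q0 harm_nonneg[of N, where 'a = real]
    by (simp add: H_def N_def power_mult_distrib algebra_simps)
qed

section \<open>Maximum principle and summation by parts\<close>

lemma finite_box [simp]: "finite {z. sup_norm (z - c) \<le> s}"
proof (rule finite_subset)
  show "{z. sup_norm (z - c) \<le> s} \<subseteq> {fst c - s..fst c + s} \<times> {snd c - s..snd c + s}"
    by (auto simp: sup_norm_def)
qed simp

lemma finite_box0 [simp]: "finite {z. sup_norm z \<le> s}"
  using finite_box[of 0 s] by simp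

lemma sup_norm_adj: "adj x y \<Longrightarrow> sup_norm (y - c) \<le> sup_norm (x - c) + 1"
  by (auto simp: adj_def sup_norm_def)

text \<open>At a maximizer strictly inside the box all terms of the node sum are nonnegative, so
  they must all vanish.\<close>

lemma maximum_principle:
  fixes h :: "vertex \<Rightarrow> real" and r :: "vertex set \<Rightarrow> real"
  assumes r: "\<And>x y. adj x y \<Longrightarrow> 0 < r {x, y}"
    and node: "\<And>z. sup_norm (z - c) < s \<Longrightarrow> (\<Sum>y\<in>{y. adj z y}. (h z - h y) / r {z, y}) = 0"
    and x: "sup_norm (x - c) \<le> s"
  shows "\<exists>z. sup_norm (z - c) = s \<and> h x \<le> h z"
proof -
  define B where "B = {z. sup_norm (z - c) \<le> s}"
  define m where "m = Max (h ` B)"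
  define Z where "Z = {z \<in> B. h z = m}"
  have B: "finite B" "x \<in> B" using x by (auto simp: B_def)
  have hm: "h z \<le> m" if "z \<in> B" for z using that B(1) by (auto simp: m_def)
  have "m \<in> h ` B" unfolding m_def using B by (intro Max_in) auto
  then have Z: "finite Z" "Z \<noteq> {}" using B(1) by (auto simp: Z_def)
  \<comment> \<open>Among the maximizers one with the largest first coordinate is taken: its right
    neighbour, if still in the box, is strictly lower, which contradicts the node law at
    once.\<close>
  then have "Max (fst ` Z) \<in> fst ` Z" by (intro Max_in) auto
  then obtain z where z: "z \<in> Z" "fst z = Max (fst ` Z)" by force
  have zmax: "fst w \<le> fst z" if "w \<in> Z" for w
    unfolding z(2) using that Z(1) by (intro Max_ge) auto
  have zB: "z \<in> B" "h z = m" using z(1) by (auto simp: Z_def)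
  have "sup_norm (z - c) = s"
  proof (rule ccontr)
    assume "sup_norm (z - c) \<noteq> s"
    with zB(1) have lt: "sup_norm (z - c) < s" by (auto simp: B_def)
    have nb: "y \<in> B" if "adj z y" for y
      using sup_norm_adj[OF that, of c] lt by (auto simp: B_def)
    define w where "w = (fst z + 1, snd z)"
    have w: "adj z w" by (simp add: w_def adj_def)
    have "w \<notin> Z" using zmax[of w] by (auto simp: w_def)
    with nb[OF w] hm[of w] have "h w < m" by (force simp: Z_def)
    have "0 < (\<Sum>y\<in>{y. adj z y}. (h z - h y) / r {z, y})"
    proof (rule sum_pos2[where i = w])
      show "0 < (h z - h w) / r {z, w}"
        using \<open>h w < m\<close> zB(2) r[OF w] by simp
      show "0 \<le> (h z - h y) / r {z, y}" if "y \<in> {y. adj z y}" for y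
        using that hm[OF nb, of y] zB(2) r[of z y] by simp
    qed (use w in auto)
    with node[OF lt] show False by simp
  qed
  moreover have "h x \<le> h z" using hm[OF B(2)] zB by simp
  ultimately show ?thesis by blast
qed

section \<open>Flux through large boxes and Green's formula\<close>

definition box_boundary :: "int \<Rightarrow> (vertex \<times> vertex) set" where
  "box_boundary k = {(x, y). adj x y \<and> sup_norm x \<le> k \<and> k < sup_norm y}"

lemma box_boundary_subset: "box_boundary k \<subseteq> Z2_oriented"
  by (auto simp: box_boundary_def Z2_oriented_def)

lemma card_box_boundary:
  assumes "0 \<le> k"
  shows "finite (box_boundary k)" "real (card (box_boundary k)) \<le> 8 * (of_int k + 1)"
proof -
  let ?J = "{- k..k}"
  let ?U = "(\<lambda>j. ((k, j), (k + 1, j))) ` ?J \<union> (\<lambda>j. ((- k, j), (- k - 1, j))) ` ?J \<union>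
    ((\<lambda>j. ((j, k), (j, k + 1))) ` ?J \<union> (\<lambda>j. ((j, - k), (j, - k - 1))) ` ?J)"
  have sub: "box_boundary k \<subseteq> ?U"
  proof
    fix p assume p: "p \<in> box_boundary k"
    obtain x1 x2 y1 y2 where pe: "p = ((x1, x2), (y1, y2))" by (metis surj_pair)
    from p have adj: "adj (x1, x2) (y1, y2)" and *: "\<bar>x1\<bar> \<le> k" "\<bar>x2\<bar> \<le> k" "k < \<bar>y1\<bar> \<or> k < \<bar>y2\<bar>"
      unfolding pe by (auto simp: box_boundary_def sup_norm_def)
    have J: "x1 \<in> ?J" "x2 \<in> ?J" using * by auto
    from adj have "(y1, y2) \<in> {y. adj (x1, x2) y}" by simp
    then consider "y1 = x1 + 1" "y2 = x2" | "y1 = x1 - 1" "y2 = x2"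
      | "y1 = x1" "y2 = x2 + 1" | "y1 = x1" "y2 = x2 - 1"
      unfolding neighbours_eq by auto
    then show "p \<in> ?U"
    proof cases
      case 1 with * have "x1 = k" by linarith
      with 1 J show ?thesis unfolding pe by blast
    next
      case 2 with * have "x1 = - k" by linarith
      with 2 J show ?thesis unfolding pe by blast
    next
      case 3 with * have "x2 = k" by linarith
      with 3 J show ?thesis unfolding pe by blast
    next
      case 4 with * have "x2 = - k" by linarith
      with 4 J show ?thesis unfolding pe by blast
    qed
  qed
  show "finite (box_boundary k)" by (rule finite_subset[OF sub]) simp
  have "card (box_boundary k) \<le> card ?U" by (rule card_mono[OF _ sub]) simp
  also have "\<dots> \<le> (card ?J + card ?J) + (card ?J + card ?J)"
    by (intro order_trans[OF card_Un_le] add_mono card_image_le) auto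
  finally have "card (box_boundary k) \<le> 4 * nat (2 * k + 1)" using assms by simp
  then have "real (card (box_boundary k)) \<le> real (4 * nat (2 * k + 1))" by (rule of_nat_mono)
  also have "\<dots> = 4 * (2 * of_int k + 1)" using assms by simp
  finally show "real (card (box_boundary k)) \<le> 8 * (of_int k + 1)" by simp
qed

text \<open>Recurrence of the lattice enters here: a square-summable function puts mass \<open>o(1/k)\<close> on
  infinitely many of the box boundaries, which have only \<open>O(k)\<close> edges.\<close>

lemma small_boundary_flux:
  fixes \<theta> :: "vertex \<Rightarrow> vertex \<Rightarrow> real"
  assumes summ: "(\<lambda>(x, y). (\<theta> x y)\<^sup>2) summable_on Z2_oriented" and "0 < \<epsilon>"
  shows "\<exists>k\<ge>K. (\<Sum>(x, y)\<in>box_boundary (int k). \<bar>\<theta> x y\<bar>) < \<epsilon>"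
proof (rule ccontr)
  assume "\<not> ?thesis"
  then have ge: "\<epsilon> \<le> (\<Sum>(x, y)\<in>box_boundary (int k). \<bar>\<theta> x y\<bar>)" if "k \<ge> K" for k
    using that by (auto simp: not_less)
  define t where "t k = (\<Sum>(x, y)\<in>box_boundary (int k). (\<theta> x y)\<^sup>2)" for k :: nat
  \<comment> \<open>An edge changes \<open>sup_norm\<close> by at most 1, so different boxes have
    disjoint boundaries and their energies add up to at most the total.\<close>
  have "summable t"
  proof (rule summableI_nonneg_bounded)
    fix n
    have "(\<Sum>k<n. t k) = (\<Sum>(x, y)\<in>(\<Union>k<n. box_boundary (int k)). (\<theta> x y)\<^sup>2)"
      unfolding t_def
    proof (rule sum.UNION_disjoint[symmetric])
      show "\<forall>i\<in>{..<n}. \<forall>j\<in>{..<n}. i \<noteq> j \<longrightarrow> box_boundary (int i) \<inter> box_boundary (int j) = {}"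
      proof (intro ballI impI)
        fix i j :: nat assume "i \<noteq> j"
        have "False" if "p \<in> box_boundary (int i)" "p \<in> box_boundary (int j)" for p
        proof -
          obtain x y where p: "p = (x, y)" by (cases p)
          with that have "adj x y" "sup_norm x \<le> int i" "int i < sup_norm y"
            "sup_norm x \<le> int j" "int j < sup_norm y"
            by (auto simp: box_boundary_def)
          moreover from sup_norm_adj[OF this(1), of 0] have "sup_norm y \<le> sup_norm x + 1" by simp
          ultimately show False using \<open>i \<noteq> j\<close> by linarith
        qed
        then show "box_boundary (int i) \<inter> box_boundary (int j) = {}" by blast
      qed
    qed (auto simp: card_box_boundary)
    also have "\<dots> \<le> (\<Sum>\<^sub>\<infinity>(x, y)\<in>Z2_oriented. (\<theta> x y)\<^sup>2)"
      by (rule finite_sum_le_infsum[OF summ])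
        (use box_boundary_subset in \<open>auto simp: card_box_boundary\<close>)
    finally show "(\<Sum>k<n. t k) \<le> (\<Sum>\<^sub>\<infinity>(x, y)\<in>Z2_oriented. (\<theta> x y)\<^sup>2)" .
  qed (auto simp: t_def intro!: sum_nonneg)
  \<comment> \<open>A flux of at least \<epsilon> through at most \<open>8 * (k + 1)\<close> edges
    forces, by Cauchy-Schwarz, \<open>t k\<close> to be at least
    \<open>\<epsilon>\<^sup>2 / (8 * (k + 1))\<close>; the harmonic series would then
    converge.\<close>
  moreover have "norm (\<epsilon>\<^sup>2 / 8 * inverse (real (Suc k))) \<le> t k" if "k \<ge> K" for k
  proof -
    let ?B = "box_boundary (int k)"
    have "\<epsilon>\<^sup>2 \<le> (\<Sum>(x, y)\<in>?B. \<bar>\<theta> x y\<bar>)\<^sup>2"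
      using ge[OF that] \<open>0 < \<epsilon>\<close> by (intro power_mono) auto
    also have "\<dots> \<le> real (card ?B) * t k"
      unfolding t_def using Cauchy_Schwarz_ineq_sum[of "\<lambda>_. 1" "\<lambda>(x, y). \<bar>\<theta> x y\<bar>" ?B]
      by (simp add: case_prod_beta)
    also have "\<dots> \<le> 8 * (real k + 1) * t k"
      using card_box_boundary(2)[of "int k"]
      by (intro mult_right_mono) (auto simp: t_def intro!: sum_nonneg)
    finally show ?thesis by (simp add: field_simps)
  qed
  ultimately have "summable (\<lambda>k. \<epsilon>\<^sup>2 / 8 * inverse (real (Suc k)))"
    by (rule summable_comparison_test')
  then have "summable (\<lambda>k. inverse (real (Suc k)))"
    using \<open>0 < \<epsilon>\<close> by (subst (asm) summable_cmult_iff) auto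
  with not_summable_harmonic[where 'a = real] show False
    using summable_Suc_iff[of "\<lambda>k. inverse (real k)"] by blast
qed

text \<open>Node law, source and sink become a single divergence equation, which passes directly to
  midpoints, limits and divergence-free perturbations. For \<open>x0 = y0\<close> the equivalence
  fails: antisymmetry contradicts the two normalizations, while the zero flow satisfies the
  right-hand side.\<close>

lemma unit_flow_iff:
  assumes "x0 \<noteq> y0"
  shows "unit_flow x0 y0 \<theta> \<longleftrightarrow> (\<forall>x y. adj x y \<longrightarrow> \<theta> x y = - \<theta> y x) \<and>
    (\<forall>x. (\<Sum>y\<in>{y. adj x y}. \<theta> x y) = of_bool (x = x0) - of_bool (x = y0))"
proof (cases "\<forall>x y. adj x y \<longrightarrow> \<theta> x y = - \<theta> y x")
  case True
  then have "\<theta> y y0 = - \<theta> y0 y" if "adj y0 y" for y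
    using that adj_commute by blast
  then have "(\<Sum>y\<in>{y. adj y0 y}. \<theta> y y0) = - (\<Sum>y\<in>{y. adj y0 y}. \<theta> y0 y)"
    unfolding sum_negf[symmetric] by (intro sum.cong) auto
  then have eq: "(\<Sum>y\<in>{y. adj y0 y}. \<theta> y y0) = 1 \<longleftrightarrow> (\<Sum>y\<in>{y. adj y0 y}. \<theta> y0 y) = - 1" by auto
  show ?thesis
    unfolding unit_flow_def eq
  proof (intro iffI conjI True allI; (elim conjE)?)
    fix x
    assume "\<forall>x. x \<noteq> x0 \<and> x \<noteq> y0 \<longrightarrow> (\<Sum>y\<in>{y. adj x y}. \<theta> x y) = 0"
      "(\<Sum>y\<in>{y. adj x0 y}. \<theta> x0 y) = 1" "(\<Sum>y\<in>{y. adj y0 y}. \<theta> y0 y) = - 1"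
    then show "(\<Sum>y\<in>{y. adj x y}. \<theta> x y) = of_bool (x = x0) - of_bool (x = y0)"
      using assms by (cases "x = x0"; cases "x = y0") (simp_all del: split_paired_All)
  qed (use assms in \<open>simp_all del: split_paired_All\<close>)
next
  case False
  then show ?thesis unfolding unit_flow_def by blast
qed

text \<open>Green's formula on a large box. The boundary term is a bounded function times the flux
  out of the box, which \<open>small_boundary_flux\<close> makes small; nonnegativity then permits
  shrinking the box to \<open>F\<close>. The factor 2 counts both orientations.\<close>

lemma flow_pairing_le:
  fixes \<theta> :: "vertex \<Rightarrow> vertex \<Rightarrow> real" and g :: "vertex \<Rightarrow> real"
  assumes flow: "unit_flow x0 y0 \<theta>" and neq: "x0 \<noteq> y0"
    and summ: "(\<lambda>(x, y). (\<theta> x y)\<^sup>2) summable_on Z2_oriented"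
    and bounded: "\<And>x. \<bar>g x\<bar> \<le> M"
    and nonneg: "\<And>x y. adj x y \<Longrightarrow> 0 \<le> \<theta> x y * (g x - g y)"
    and F: "finite F" "F \<subseteq> Z2_oriented"
  shows "(\<Sum>(x, y)\<in>F. \<theta> x y * (g x - g y)) \<le> 2 * (g x0 - g y0)"
proof (rule field_le_epsilon)
  fix \<epsilon> :: real assume "0 < \<epsilon>"
  have M: "0 \<le> M" using bounded[of x0] by linarith
  have anti: "\<theta> x y = - \<theta> y x" if "adj x y" for x y
    using flow that unfolding unit_flow_iff[OF neq] by blast
  have div: "(\<Sum>y\<in>{y. adj x y}. \<theta> x y) = of_bool (x = x0) - of_bool (x = y0)" for x
    using flow unfolding unit_flow_iff[OF neq] by blast
  define V where "V = insert x0 (insert y0 (fst ` F \<union> snd ` F))"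
  have V: "finite V" using F(1) by (auto simp: V_def)
  define K where "K = nat (Max (sup_norm ` V))"
  have VK: "sup_norm x \<le> int K" if "x \<in> V" for x
  proof -
    have "sup_norm x \<le> Max (sup_norm ` V)" using that V by (intro Max_ge) auto
    then show ?thesis by (simp add: K_def)
  qed
  \<comment> \<open>Multiplied by the bound \<open>M + 1\<close> on \<open>g\<close>, this leaves a
    boundary term of at most \<open>\<epsilon> / 2\<close>, which the symmetrization below doubles.
    Using \<open>M + 1\<close> keeps the denominator positive when \<open>M = 0\<close>.\<close>
  have "0 < \<epsilon> / (2 * (M + 1))" using \<open>0 < \<epsilon>\<close> M by simp
  from small_boundary_flux[OF summ this, of K] obtain k where k: "k \<ge> K"
    "(\<Sum>(x, y)\<in>box_boundary (int k). \<bar>\<theta> x y\<bar>) < \<epsilon> / (2 * (M + 1))" by blast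
  define B where "B = {x. sup_norm x \<le> int k}"
  define P where "P = {(x, y). adj x y \<and> x \<in> B \<and> y \<in> B}"
  have VB: "V \<subseteq> B" using VK k(1) by (force simp: B_def)
  have finB: "finite B" by (simp add: B_def)
  have finP: "finite P" by (rule finite_subset[of _ "B \<times> B"]) (auto simp: P_def finB)
  have FP: "F \<subseteq> P"
  proof
    fix p assume p: "p \<in> F"
    then have "fst p \<in> V" "snd p \<in> V" by (auto simp: V_def)
    with p F(2) VB show "p \<in> P" by (auto simp: P_def Z2_oriented_def)
  qed
  have "g x0 - g y0 = (\<Sum>x\<in>B. g x * (of_bool (x = x0) - of_bool (x = y0)))"
  proof -
    have "(\<Sum>x\<in>B. g x * (of_bool (x = x0) - of_bool (x = y0))) =
        (\<Sum>x\<in>B. (if x = x0 then g x else 0) - (if x = y0 then g x else 0))"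
      by (rule sum.cong) auto
    then show ?thesis using VB finB by (simp add: sum_subtractf V_def)
  qed
  also have "\<dots> = (\<Sum>x\<in>B. \<Sum>y\<in>{y. adj x y}. \<theta> x y * g x)"
    unfolding div[symmetric] by (simp add: sum_distrib_left mult.commute)
  also have "\<dots> = (\<Sum>(x, y)\<in>(SIGMA x:B. {y. adj x y}). \<theta> x y * g x)"
    using finB by (subst sum.Sigma) auto
  also have "(SIGMA x:B. {y. adj x y}) = P \<union> box_boundary (int k)"
    by (auto simp: P_def B_def box_boundary_def)
  also have "(\<Sum>(x, y)\<in>P \<union> box_boundary (int k). \<theta> x y * g x) =
      (\<Sum>(x, y)\<in>P. \<theta> x y * g x) + (\<Sum>(x, y)\<in>box_boundary (int k). \<theta> x y * g x)"
    by (intro sum.union_disjoint finP card_box_boundary) (auto simp: P_def B_def box_boundary_def)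
  finally have eq: "g x0 - g y0 = \<dots>" .
  \<comment> \<open>\<open>P\<close> is invariant under reversal of edges and \<theta> is odd, which
    turns vertex values of \<open>g\<close> into increments.\<close>
  have "(\<Sum>(x, y)\<in>P. \<theta> x y * g x) = (\<Sum>(x, y)\<in>P. \<theta> y x * g y)"
    by (rule sum.reindex_bij_witness[of _ prod.swap prod.swap]) (auto simp: P_def adj_commute)
  also have "\<dots> = - (\<Sum>(x, y)\<in>P. \<theta> x y * g y)"
    unfolding sum_negf[symmetric] by (rule sum.cong) (auto simp: P_def anti[of _ _])
  finally have "2 * (\<Sum>(x, y)\<in>P. \<theta> x y * g x) = (\<Sum>(x, y)\<in>P. \<theta> x y * (g x - g y))"
    by (simp add: case_prod_beta right_diff_distrib sum_subtractf)
  moreover have "\<bar>\<Sum>(x, y)\<in>box_boundary (int k). \<theta> x y * g x\<bar> \<le> \<epsilon> / 2"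
  proof -
    have "\<bar>\<Sum>(x, y)\<in>box_boundary (int k). \<theta> x y * g x\<bar> \<le>
        (\<Sum>(x, y)\<in>box_boundary (int k). \<bar>\<theta> x y\<bar> * (M + 1))"
    proof (rule order_trans[OF sum_abs sum_mono])
      fix p :: "vertex \<times> vertex"
      have "\<bar>g (fst p)\<bar> \<le> M + 1" using bounded[of "fst p"] by linarith
      then show "\<bar>case p of (x, y) \<Rightarrow> \<theta> x y * g x\<bar> \<le> (case p of (x, y) \<Rightarrow> \<bar>\<theta> x y\<bar> * (M + 1))"
        by (auto simp: case_prod_beta abs_mult intro: mult_left_mono)
    qed
    also have "\<dots> = (M + 1) * (\<Sum>(x, y)\<in>box_boundary (int k). \<bar>\<theta> x y\<bar>)"
      by (simp add: sum_distrib_left case_prod_beta mult.commute)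
    also have "\<dots> \<le> (M + 1) * (\<epsilon> / (2 * (M + 1)))"
      using k(2) M by (intro mult_left_mono) auto
    also have "\<dots> = \<epsilon> / 2" using M by (simp add: field_simps)
    finally show ?thesis .
  qed
  moreover have "(\<Sum>(x, y)\<in>F. \<theta> x y * (g x - g y)) \<le> (\<Sum>(x, y)\<in>P. \<theta> x y * (g x - g y))"
    by (rule sum_mono2[OF finP FP]) (auto simp: P_def nonneg)
  moreover have "s \<le> 2 * u + \<epsilon>" if "2 * p = q" "\<bar>d\<bar> \<le> \<epsilon> / 2" "s \<le> q" "u = p + d" for p q d s u :: real
    using that by linarith
  ultimately show "(\<Sum>(x, y)\<in>F. \<theta> x y * (g x - g y)) \<le> 2 * (g x0 - g y0) + \<epsilon>"
    using eq by blast
qed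

section \<open>Estimates for a unit current\<close>

text \<open>Ohm's law makes \<open>h\<close> a potential, and square-summability prevents flux from
  escaping to infinity. The constants obtained below depend on \<open>r\<close> only through
  \<open>a\<close> and \<open>b\<close>, so the bounds are uniform over environments.\<close>

locale unit_current =
  fixes a b :: real and r :: "vertex set \<Rightarrow> real" and x0 y0 :: vertex
    and \<theta> :: "vertex \<Rightarrow> vertex \<Rightarrow> real" and h :: "vertex \<Rightarrow> real"
  assumes a_pos: "0 < a"
    and r_bounds: "\<And>x y. adj x y \<Longrightarrow> a \<le> r {x, y} \<and> r {x, y} \<le> b"
    and flow: "unit_flow x0 y0 \<theta>" and neq: "x0 \<noteq> y0"
    and square_summable: "(\<lambda>(x, y). (\<theta> x y)\<^sup>2) summable_on Z2_oriented"
    and ohm: "\<And>x y. adj x y \<Longrightarrow> h x - h y = r {x, y} * \<theta> x y"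
begin

text \<open>Truncation makes the potential bounded, as \<open>flow_pairing_le\<close> requires, and
  isolates the energy dissipated between two levels.\<close>

definition clamp :: "real \<Rightarrow> real \<Rightarrow> vertex \<Rightarrow> real" where
  "clamp \<alpha> \<beta> x = max \<alpha> (min \<beta> (h x))"

lemma a_le_b: "a \<le> b"
  using r_bounds[of "(0, 0)" "(1, 0)"] by (simp add: adj_def)

lemma r_pos: "adj x y \<Longrightarrow> 0 < r {x, y}"
  using r_bounds[of x y] a_pos by linarith

lemma current_eq: "adj x y \<Longrightarrow> \<theta> x y = (h x - h y) / r {x, y}"
  using ohm[of x y] r_pos[of x y] by (simp add: field_simps)

lemma abs_current_le: "adj x y \<Longrightarrow> \<bar>\<theta> x y\<bar> \<le> \<bar>h x - h y\<bar> / a"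
  unfolding current_eq abs_divide using r_bounds[of x y] a_pos by (intro frac_le) auto

text \<open>Truncation is monotone and 1-Lipschitz: its increment has the sign of the increment of
  \<open>h\<close> and is no larger.\<close>

lemma clamp_increment:
  assumes "adj x y"
  shows "(clamp \<alpha> \<beta> x - clamp \<alpha> \<beta> y)\<^sup>2 \<le> (h x - h y) * (clamp \<alpha> \<beta> x - clamp \<alpha> \<beta> y)"
proof -
  have "0 \<le> (clamp \<alpha> \<beta> x - clamp \<alpha> \<beta> y) \<and> clamp \<alpha> \<beta> x - clamp \<alpha> \<beta> y \<le> h x - h y \<or>
     0 \<le> (clamp \<alpha> \<beta> y - clamp \<alpha> \<beta> x) \<and> clamp \<alpha> \<beta> y - clamp \<alpha> \<beta> x \<le> h y - h x"
    unfolding clamp_def by linarith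
  then show ?thesis
  proof
    assume "0 \<le> (clamp \<alpha> \<beta> x - clamp \<alpha> \<beta> y) \<and> clamp \<alpha> \<beta> x - clamp \<alpha> \<beta> y \<le> h x - h y"
    then show ?thesis unfolding power2_eq_square by (intro mult_right_mono) auto
  next
    assume "0 \<le> (clamp \<alpha> \<beta> y - clamp \<alpha> \<beta> x) \<and> clamp \<alpha> \<beta> y - clamp \<alpha> \<beta> x \<le> h y - h x"
    then show ?thesis unfolding power2_eq_square by (intro mult_right_mono_neg) auto
  qed
qed

lemma clamp_increment_current:
  assumes "adj x y"
  shows "(clamp \<alpha> \<beta> x - clamp \<alpha> \<beta> y)\<^sup>2 \<le> b * (\<theta> x y * (clamp \<alpha> \<beta> x - clamp \<alpha> \<beta> y))"
    and "0 \<le> \<theta> x y * (clamp \<alpha> \<beta> x - clamp \<alpha> \<beta> y)"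
proof -
  have *: "(clamp \<alpha> \<beta> x - clamp \<alpha> \<beta> y)\<^sup>2 \<le> r {x, y} * (\<theta> x y * (clamp \<alpha> \<beta> x - clamp \<alpha> \<beta> y))"
    using clamp_increment[OF assms] ohm[OF assms] by (simp add: mult.assoc)
  moreover have "0 \<le> (clamp \<alpha> \<beta> x - clamp \<alpha> \<beta> y)\<^sup>2" by simp
  ultimately have "0 \<le> r {x, y} * (\<theta> x y * (clamp \<alpha> \<beta> x - clamp \<alpha> \<beta> y))" by linarith
  then show nn: "0 \<le> \<theta> x y * (clamp \<alpha> \<beta> x - clamp \<alpha> \<beta> y)"
    using r_pos[OF assms] by (simp add: zero_le_mult_iff)
  have "r {x, y} * (\<theta> x y * (clamp \<alpha> \<beta> x - clamp \<alpha> \<beta> y)) \<le> b * (\<theta> x y * (clamp \<alpha> \<beta> x - clamp \<alpha> \<beta> y))"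
    using nn r_bounds[OF assms] by (intro mult_right_mono) auto
  with * show "(clamp \<alpha> \<beta> x - clamp \<alpha> \<beta> y)\<^sup>2 \<le> b * (\<theta> x y * (clamp \<alpha> \<beta> x - clamp \<alpha> \<beta> y))"
    by linarith
qed

text \<open>A unit current through a potential drop of \<open>\<beta> - \<alpha>\<close> dissipates energy \<open>\<beta> - \<alpha>\<close>.\<close>

lemma clamp_energy:
  assumes "finite F" "F \<subseteq> Z2_oriented" "\<alpha> \<le> \<beta>"
  shows "(\<Sum>(x, y)\<in>F. \<theta> x y * (clamp \<alpha> \<beta> x - clamp \<alpha> \<beta> y)) \<le> 2 * (clamp \<alpha> \<beta> x0 - clamp \<alpha> \<beta> y0)"
proof (rule flow_pairing_le[OF flow neq square_summable _ _ assms(1,2)])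
  show "\<bar>clamp \<alpha> \<beta> x\<bar> \<le> max \<bar>\<alpha>\<bar> \<bar>\<beta>\<bar>" for x
    using assms(3) unfolding clamp_def by linarith
qed (rule clamp_increment_current)

lemma clamp_diff_le: "\<alpha> \<le> \<beta> \<Longrightarrow> clamp \<alpha> \<beta> x - clamp \<alpha> \<beta> y \<le> \<beta> - \<alpha>"
  unfolding clamp_def by linarith

lemma dirichlet_le_clamp:
  assumes "\<alpha> \<le> \<beta>"
  shows "dirichlet_le (clamp \<alpha> \<beta>) (2 * b * (\<beta> - \<alpha>))"
  unfolding dirichlet_le_def
proof (intro allI impI)
  fix F assume F: "finite F" "F \<subseteq> Z2_oriented"
  have "(\<Sum>(x, y)\<in>F. (clamp \<alpha> \<beta> x - clamp \<alpha> \<beta> y)\<^sup>2) \<le>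
      (\<Sum>(x, y)\<in>F. b * (\<theta> x y * (clamp \<alpha> \<beta> x - clamp \<alpha> \<beta> y)))"
    using F(2) by (intro sum_mono) (auto simp: Z2_oriented_def intro: clamp_increment_current(1))
  also have "\<dots> = b * (\<Sum>(x, y)\<in>F. \<theta> x y * (clamp \<alpha> \<beta> x - clamp \<alpha> \<beta> y))"
    by (simp add: sum_distrib_left case_prod_beta)
  also have "\<dots> \<le> b * (2 * (\<beta> - \<alpha>))"
    using clamp_energy[OF F assms] clamp_diff_le[OF assms, of x0 y0] a_pos a_le_b
    by (intro mult_left_mono) auto
  finally show "(\<Sum>(x, y)\<in>F. (clamp \<alpha> \<beta> x - clamp \<alpha> \<beta> y)\<^sup>2) \<le> 2 * b * (\<beta> - \<alpha>)"
    by (simp add: algebra_simps)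
qed

text \<open>With the levels at the two values themselves, the truncation still has the full
  difference \<delta> but energy only \<open>2 * b * \<delta>\<close>. The modulus then reads
  \<open>\<delta>\<^sup>2 \<le> 162 * b * H * \<delta>\<close>, where one factor \<delta>
  cancels.\<close>

lemma potential_diff_le: "\<bar>h x - h y\<bar> \<le> 162 * b * (1 + harm (nat (sup_norm (y - x))))"
proof -
  define \<alpha> where "\<alpha> = min (h x) (h y)"
  define \<beta> where "\<beta> = max (h x) (h y)"
  define H where "H = (1 + harm (nat (sup_norm (y - x))) :: real)"
  have "\<alpha> \<le> \<beta>" by (simp add: \<alpha>_def \<beta>_def)
  have "clamp \<alpha> \<beta> x - clamp \<alpha> \<beta> y = h x - h y" by (auto simp: clamp_def \<alpha>_def \<beta>_def)
  with logarithmic_modulus[OF dirichlet_le_clamp[OF \<open>\<alpha> \<le> \<beta>\<close>], of x y]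
  have "(h x - h y)\<^sup>2 \<le> 81 * H * (2 * b * (\<beta> - \<alpha>))" by (simp add: H_def)
  moreover have "\<beta> - \<alpha> = \<bar>h x - h y\<bar>" by (simp add: \<alpha>_def \<beta>_def)
  ultimately have "\<bar>h x - h y\<bar> * \<bar>h x - h y\<bar> \<le> (162 * b * H) * \<bar>h x - h y\<bar>"
    by (simp add: power2_eq_square algebra_simps)
  moreover have "0 \<le> 162 * b * H"
    using a_pos a_le_b harm_nonneg[of "nat (sup_norm (y - x))", where 'a = real] by (simp add: H_def)
  ultimately show ?thesis
    unfolding H_def[symmetric]
    by (cases "h x = h y") (simp, metis mult_right_le_imp_le right_minus_eq zero_less_abs_iff)
qed

lemma node_law: "x \<noteq> x0 \<Longrightarrow> x \<noteq> y0 \<Longrightarrow> (\<Sum>y\<in>{y. adj x y}. (h x - h y) / r {x, y}) = 0"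
proof -
  assume "x \<noteq> x0" "x \<noteq> y0"
  then have "(\<Sum>y\<in>{y. adj x y}. \<theta> x y) = 0" using flow unfolding unit_flow_def by blast
  also have "(\<Sum>y\<in>{y. adj x y}. \<theta> x y) = (\<Sum>y\<in>{y. adj x y}. (h x - h y) / r {x, y})"
    by (rule sum.cong) (auto intro: current_eq)
  finally show ?thesis .
qed

text \<open>The same cancellation, now against the rings around \<open>x\<close>: by the maximum
  principle for \<open>h\<close> and \<open>- h\<close> each of them meets both levels, so the
  truncation oscillates by \<delta> on every ring up to radius \<open>S\<close>.\<close>

lemma potential_step_le:
  assumes "adj x y" "int S \<le> sup_norm (x - x0)" "int S \<le> sup_norm (x - y0)"
  shows "\<bar>h x - h y\<bar> * harm S \<le> 256 * b"
proof -
  define \<alpha> where "\<alpha> = min (h x) (h y)"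
  define \<beta> where "\<beta> = max (h x) (h y)"
  have "\<alpha> \<le> \<beta>" by (simp add: \<alpha>_def \<beta>_def)
  have \<delta>: "\<beta> - \<alpha> = \<bar>h x - h y\<bar>" by (simp add: \<alpha>_def \<beta>_def)
  define f where "f = (\<lambda>z. clamp \<alpha> \<beta> (x + z))"
  have D: "dirichlet_le f (2 * b * (\<beta> - \<alpha>))"
    unfolding f_def by (rule dirichlet_le_comp[OF dirichlet_le_clamp[OF \<open>\<alpha> \<le> \<beta>\<close>]])
      (auto simp: inj_def adj_def)
  have "(\<beta> - \<alpha>)\<^sup>2 * harm S \<le> 128 * (2 * b * (\<beta> - \<alpha>))"
  proof (rule ring_oscillation[OF D])
    fix s assume s: "1 \<le> s" "s \<le> S"
    \<comment> \<open>The maximum principle uses the node law only strictly inside the box; both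
      poles have distance at least \<open>S\<close> from \<open>x\<close>, so at worst they lie on
      the outermost ring.\<close>
    have inner: "z \<noteq> x0 \<and> z \<noteq> y0" if "sup_norm (z - x) < int s" for z
    proof -
      have "sup_norm (z - x) = sup_norm (x - z)" by (simp add: sup_norm_def abs_minus_commute)
      with that s(2) assms(2,3) show ?thesis by auto
    qed
    have node: "(\<Sum>y\<in>{y. adj z y}. (h z - h y) / r {z, y}) = 0" if "sup_norm (z - x) < int s" for z
      using node_law[of z] inner[OF that] by blast
    have node': "(\<Sum>y\<in>{y. adj z y}. (- h z - - h y) / r {z, y}) = 0" if "sup_norm (z - x) < int s" for z
    proof -
      have "(\<Sum>y\<in>{y. adj z y}. (- h z - - h y) / r {z, y}) = - (\<Sum>y\<in>{y. adj z y}. (h z - h y) / r {z, y})"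
        unfolding sum_negf[symmetric] by (rule sum.cong) (auto simp: minus_divide_left)
      with node[OF that] show ?thesis by simp
    qed
    have x: "sup_norm (x - x) \<le> int s" by (simp add: sup_norm_def)
    have y: "sup_norm (y - x) \<le> int s" using sup_norm_adj[OF assms(1), of x] s(1)
      by (simp add: sup_norm_def)
    have ex: "\<exists>z. sup_norm (z - x) = int s \<and> \<beta> \<le> h z" "\<exists>w. sup_norm (w - x) = int s \<and> h w \<le> \<alpha>"
    proof -
      show "\<exists>z. sup_norm (z - x) = int s \<and> \<beta> \<le> h z"
        using maximum_principle[OF r_pos node x] maximum_principle[OF r_pos node y]
        unfolding \<beta>_def max_def by (auto split: if_splits)
      show "\<exists>w. sup_norm (w - x) = int s \<and> h w \<le> \<alpha>"
        using maximum_principle[OF r_pos node' x] maximum_principle[OF r_pos node' y]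
        unfolding \<alpha>_def min_def by (auto split: if_splits)
    qed
    then obtain z w where zw: "sup_norm (z - x) = int s" "\<beta> \<le> h z" "sup_norm (w - x) = int s" "h w \<le> \<alpha>"
      by blast
    have "f (z - x) = \<beta>" "f (w - x) = \<alpha>"
      using zw \<open>\<alpha> \<le> \<beta>\<close> by (auto simp: f_def clamp_def)
    with zw show "\<exists>z w. sup_norm z = int s \<and> sup_norm w = int s \<and> \<beta> - \<alpha> \<le> \<bar>f z - f w\<bar>"
      by (intro exI[of _ "z - x"] exI[of _ "w - x"]) auto
  qed (use \<open>\<alpha> \<le> \<beta>\<close> in simp)
  then have "(\<beta> - \<alpha>) * ((\<beta> - \<alpha>) * harm S) \<le> (\<beta> - \<alpha>) * (256 * b)"
    by (simp add: power2_eq_square algebra_simps)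
  then show ?thesis
    unfolding \<delta>[symmetric] using \<open>\<alpha> \<le> \<beta>\<close> a_pos a_le_b
    by (cases "\<alpha> = \<beta>") (auto simp: mult_le_cancel_left)
qed

text \<open>On edges with both ends between the levels the truncation agrees with \<open>h\<close>,
  and the pairing with \<theta> is exactly the dissipated energy
  \<open>r {x, y} * (\<theta> x y)\<^sup>2\<close>.\<close>

lemma energy_within_levels:
  assumes F: "finite F" "F \<subseteq> Z2_oriented"
    and levels: "\<And>x y. (x, y) \<in> F \<Longrightarrow> \<alpha> \<le> h x \<and> h x \<le> \<beta> \<and> \<alpha> \<le> h y \<and> h y \<le> \<beta>"
    and "\<alpha> \<le> \<beta>"
  shows "a * (\<Sum>(x, y)\<in>F. (\<theta> x y)\<^sup>2) \<le> 2 * (clamp \<alpha> \<beta> x0 - clamp \<alpha> \<beta> y0)"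
proof -
  have "a * (\<Sum>(x, y)\<in>F. (\<theta> x y)\<^sup>2) = (\<Sum>(x, y)\<in>F. a * (\<theta> x y)\<^sup>2)"
    by (simp add: sum_distrib_left case_prod_beta)
  also have "\<dots> \<le> (\<Sum>(x, y)\<in>F. \<theta> x y * (clamp \<alpha> \<beta> x - clamp \<alpha> \<beta> y))"
  proof (rule sum_mono)
    fix p assume p: "p \<in> F"
    obtain x y where xy: "p = (x, y)" by (cases p)
    have adj: "adj x y" using p xy F(2) by (auto simp: Z2_oriented_def)
    have "clamp \<alpha> \<beta> x - clamp \<alpha> \<beta> y = r {x, y} * \<theta> x y"
      using levels[of x y] p xy ohm[OF adj] by (auto simp: clamp_def)
    then have "\<theta> x y * (clamp \<alpha> \<beta> x - clamp \<alpha> \<beta> y) = r {x, y} * (\<theta> x y)\<^sup>2"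
      by (simp add: power2_eq_square)
    moreover have "a * (\<theta> x y)\<^sup>2 \<le> r {x, y} * (\<theta> x y)\<^sup>2"
      using r_bounds[OF adj] by (intro mult_right_mono) auto
    ultimately show "(case p of (x, y) \<Rightarrow> a * (\<theta> x y)\<^sup>2) \<le>
        (case p of (x, y) \<Rightarrow> \<theta> x y * (clamp \<alpha> \<beta> x - clamp \<alpha> \<beta> y))" by (simp add: xy)
  qed
  also have "\<dots> \<le> 2 * (clamp \<alpha> \<beta> x0 - clamp \<alpha> \<beta> y0)"
    by (rule clamp_energy[OF F \<open>\<alpha> \<le> \<beta>\<close>])
  finally show ?thesis .
qed

text \<open>Taking as levels the extreme values of \<open>h\<close> on the ends of \<open>F\<close>
  and on the poles leaves \<open>h\<close> unchanged at the poles.\<close>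

lemma total_energy:
  assumes F: "finite F" "F \<subseteq> Z2_oriented"
  shows "a * (\<Sum>(x, y)\<in>F. (\<theta> x y)\<^sup>2) \<le> 2 * (h x0 - h y0)"
proof -
  define V where "V = insert x0 (insert y0 (fst ` F \<union> snd ` F))"
  have V: "finite (h ` V)" using F(1) by (simp add: V_def)
  define \<alpha> where "\<alpha> = Min (h ` V)"
  define \<beta> where "\<beta> = Max (h ` V)"
  have lev: "\<alpha> \<le> h x \<and> h x \<le> \<beta>" if "x \<in> V" for x
    using that V by (auto simp: \<alpha>_def \<beta>_def)
  have "clamp \<alpha> \<beta> x0 = h x0" "clamp \<alpha> \<beta> y0 = h y0"
    using lev[of x0] lev[of y0] by (auto simp: clamp_def V_def)
  moreover have "a * (\<Sum>(x, y)\<in>F. (\<theta> x y)\<^sup>2) \<le> 2 * (clamp \<alpha> \<beta> x0 - clamp \<alpha> \<beta> y0)"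
  proof (rule energy_within_levels[OF F])
    fix x y assume "(x, y) \<in> F"
    then have "x \<in> V" "y \<in> V" by (force simp: V_def)+
    then show "\<alpha> \<le> h x \<and> h x \<le> \<beta> \<and> \<alpha> \<le> h y \<and> h y \<le> \<beta>" using lev by blast
  next
    show "\<alpha> \<le> \<beta>" using lev[of x0] by (simp add: V_def)
  qed
  ultimately show ?thesis by simp
qed

text \<open>By \<open>potential_diff_le\<close> the potential in the ball stays within
  \<open>H\<close> of \<open>h c\<close>. A window of width \<open>2 * H\<close> carries energy at
  most \<open>4 * H\<close> over oriented edges, however large the total energy is.\<close>

lemma energy_in_ball:
  assumes F: "finite F" "F \<subseteq> Z2_oriented" and K: "\<And>x y. (x, y) \<in> F \<Longrightarrow> sup_norm (x - c) < int K"
  shows "a * (\<Sum>(x, y)\<in>F. (\<theta> x y)\<^sup>2) \<le> 648 * b * (1 + harm K)"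
proof -
  define H where "H = 162 * b * (1 + harm K)"
  have b: "0 \<le> b" using a_pos a_le_b by simp
  have H0: "0 \<le> H" using b harm_nonneg[of K, where 'a = real] by (simp add: H_def)
  have near: "\<bar>h x - h c\<bar> \<le> H" if "sup_norm (x - c) \<le> int K" for x
  proof -
    have "\<bar>h c - h x\<bar> \<le> 162 * b * (1 + harm (nat (sup_norm (x - c))))"
      by (rule potential_diff_le)
    also have "\<dots> \<le> H"
      unfolding H_def using that b by (intro mult_left_mono add_left_mono harm_mono) auto
    finally show ?thesis by linarith
  qed
  have "a * (\<Sum>(x, y)\<in>F. (\<theta> x y)\<^sup>2) \<le> 2 * (clamp (h c - H) (h c + H) x0 - clamp (h c - H) (h c + H) y0)"
  proof (rule energy_within_levels[OF F])
    fix x y assume xy: "(x, y) \<in> F"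
    then have "adj x y" using F(2) by (auto simp: Z2_oriented_def)
    from sup_norm_adj[OF this, of c] K[OF xy] near[of x] near[of y]
    show "h c - H \<le> h x \<and> h x \<le> h c + H \<and> h c - H \<le> h y \<and> h y \<le> h c + H" by auto
  qed (use H0 in simp)
  also have "\<dots> \<le> 2 * (2 * H)"
    using clamp_diff_le[of "h c - H" "h c + H" x0 y0] H0 by simp
  finally show ?thesis by (simp add: H_def)
qed

end

section \<open>Existence of the minimal flow\<close>

definition elliptic :: "real \<Rightarrow> real \<Rightarrow> (vertex set \<Rightarrow> real) \<Rightarrow> bool" where
  "elliptic a b r \<longleftrightarrow> 0 < a \<and> (\<forall>x y. adj x y \<longrightarrow> a \<le> r {x, y} \<and> r {x, y} \<le> b)"

definition finite_energy :: "(vertex \<Rightarrow> vertex \<Rightarrow> real) \<Rightarrow> bool" where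
  "finite_energy \<theta> \<longleftrightarrow> (\<lambda>(x, y). (\<theta> x y)\<^sup>2) summable_on Z2_oriented"

text \<open>Both orientations are summed, so this is twice the energy; hence the recurring
  \<open>/ 2\<close>.\<close>

definition real_energy :: "(vertex set \<Rightarrow> real) \<Rightarrow> (vertex \<Rightarrow> vertex \<Rightarrow> real) \<Rightarrow> real" where
  "real_energy r \<theta> = (\<Sum>\<^sub>\<infinity>(x, y)\<in>Z2_oriented. r {x, y} * (\<theta> x y)\<^sup>2)"

lemma ellipticD:
  assumes "elliptic a b r" "adj x y"
  shows "0 < a" "a \<le> r {x, y}" "r {x, y} \<le> b"
  using assms unfolding elliptic_def by blast+

lemma elliptic_nonneg:
  assumes "elliptic a b r" "(x, y) \<in> Z2_oriented"
  shows "0 \<le> r {x, y} * c\<^sup>2"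
  using ellipticD[OF assms(1), of x y] assms(2) by (simp add: Z2_oriented_def)

lemma weighted_summable_iff:
  assumes "elliptic a b r"
  shows "(\<lambda>(x, y). r {x, y} * (\<theta> x y)\<^sup>2) summable_on Z2_oriented \<longleftrightarrow> finite_energy \<theta>"
proof
  assume "(\<lambda>(x, y). r {x, y} * (\<theta> x y)\<^sup>2) summable_on Z2_oriented"
  then have "(\<lambda>p. (1 / a) * (case p of (x, y) \<Rightarrow> r {x, y} * (\<theta> x y)\<^sup>2)) summable_on Z2_oriented"
    by (rule summable_on_cmult_right)
  then show "finite_energy \<theta>"
    unfolding finite_energy_def
  proof (rule summable_on_comparison_test)
    fix p assume p: "p \<in> Z2_oriented"
    obtain x y where xy: "p = (x, y)" by (cases p)
    have "0 < a" "a \<le> r {x, y}" using ellipticD[OF assms, of x y] p xy by (auto simp: Z2_oriented_def)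
    then have "a * (\<theta> x y)\<^sup>2 \<le> r {x, y} * (\<theta> x y)\<^sup>2" by (intro mult_right_mono) auto
    with \<open>0 < a\<close> show "(case p of (x, y) \<Rightarrow> (\<theta> x y)\<^sup>2) \<le> (1 / a) * (case p of (x, y) \<Rightarrow> r {x, y} * (\<theta> x y)\<^sup>2)"
      by (simp add: xy field_simps)
  qed (auto simp: case_prod_beta)
next
  assume "finite_energy \<theta>"
  then have "(\<lambda>p. b * (case p of (x, y) \<Rightarrow> (\<theta> x y)\<^sup>2)) summable_on Z2_oriented"
    unfolding finite_energy_def by (rule summable_on_cmult_right)
  then show "(\<lambda>(x, y). r {x, y} * (\<theta> x y)\<^sup>2) summable_on Z2_oriented"
  proof (rule summable_on_comparison_test)
    fix p assume "p \<in> Z2_oriented"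
    then show "(case p of (x, y) \<Rightarrow> r {x, y} * (\<theta> x y)\<^sup>2) \<le> b * (case p of (x, y) \<Rightarrow> (\<theta> x y)\<^sup>2)"
      using ellipticD(3)[OF assms] by (auto simp: Z2_oriented_def intro!: mult_right_mono)
  qed (auto intro: elliptic_nonneg[OF assms])
qed

lemma partial_sum_le_real_energy:
  assumes "elliptic a b r" "finite_energy \<theta>" "finite F" "F \<subseteq> Z2_oriented"
  shows "(\<Sum>(x, y)\<in>F. r {x, y} * (\<theta> x y)\<^sup>2) \<le> real_energy r \<theta>"
  unfolding real_energy_def
  by (rule finite_sum_le_infsum)
    (use assms in \<open>auto simp: weighted_summable_iff intro: elliptic_nonneg\<close>)

lemma real_energy_nonneg: "elliptic a b r \<Longrightarrow> 0 \<le> real_energy r \<theta>"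
  unfolding real_energy_def by (rule infsum_nonneg) (auto intro: elliptic_nonneg)

lemma finite_energy_bounded:
  assumes ell: "elliptic a b r"
    and le: "\<And>F. finite F \<Longrightarrow> F \<subseteq> Z2_oriented \<Longrightarrow> (\<Sum>(x, y)\<in>F. r {x, y} * (\<theta> x y)\<^sup>2) \<le> s"
  shows "finite_energy \<theta>" "real_energy r \<theta> \<le> s"
proof -
  have summ: "(\<lambda>(x, y). r {x, y} * (\<theta> x y)\<^sup>2) summable_on Z2_oriented"
    by (rule nonneg_bdd_above_summable_on)
      (use le in \<open>auto intro: elliptic_nonneg[OF ell] bdd_aboveI2[of _ _ s]\<close>)
  then show "finite_energy \<theta>" by (simp add: weighted_summable_iff[OF ell])
  show "real_energy r \<theta> \<le> s"
    unfolding real_energy_def by (rule infsum_le_finite_sums[OF summ]) (use le in auto)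
qed

lemma energy_eq_SUP:
  assumes "elliptic a b r"
  shows "energy r \<theta> =
    (SUP F\<in>{F. finite F \<and> F \<subseteq> Z2_oriented}. ennreal (\<Sum>(x, y)\<in>F. r {x, y} * (\<theta> x y)\<^sup>2)) / 2"
proof -
  have "(\<Sum>\<^sub>\<infinity>(x, y)\<in>Z2_oriented. ennreal (r {x, y} * (\<theta> x y)\<^sup>2)) =
      (SUP F\<in>{F. finite F \<and> F \<subseteq> Z2_oriented}. \<Sum>(x, y)\<in>F. ennreal (r {x, y} * (\<theta> x y)\<^sup>2))"
    by (rule nonneg_infsum_complete) simp
  also have "\<dots> = (SUP F\<in>{F. finite F \<and> F \<subseteq> Z2_oriented}. ennreal (\<Sum>(x, y)\<in>F. r {x, y} * (\<theta> x y)\<^sup>2))"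
  proof (rule SUP_cong[OF refl])
    fix F assume F: "F \<in> {F. finite F \<and> F \<subseteq> Z2_oriented}"
    have "(\<Sum>p\<in>F. ennreal (case p of (x, y) \<Rightarrow> r {x, y} * (\<theta> x y)\<^sup>2)) =
        ennreal (\<Sum>(x, y)\<in>F. r {x, y} * (\<theta> x y)\<^sup>2)"
      by (rule sum_ennreal) (use F elliptic_nonneg[OF assms] in auto)
    then show "(\<Sum>(x, y)\<in>F. ennreal (r {x, y} * (\<theta> x y)\<^sup>2)) =
        ennreal (\<Sum>(x, y)\<in>F. r {x, y} * (\<theta> x y)\<^sup>2)"
      by (simp add: case_prod_beta)
  qed
  finally show ?thesis by (simp add: energy_def)
qed

lemma energy_eq_real_energy:
  assumes "elliptic a b r" "finite_energy \<theta>"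
  shows "energy r \<theta> = ennreal (real_energy r \<theta> / 2)"
proof -
  have "ennreal (real_energy r \<theta>) =
    (SUP F\<in>{F. finite F \<and> F \<subseteq> Z2_oriented}. ennreal (\<Sum>(x, y)\<in>F. r {x, y} * (\<theta> x y)\<^sup>2))"
    unfolding real_energy_def
    by (rule infsum_nonneg_is_SUPREMUM_ennreal)
      (use assms in \<open>auto simp: weighted_summable_iff intro: elliptic_nonneg\<close>)
  then have "energy r \<theta> = ennreal (real_energy r \<theta>) / ennreal 2"
    by (simp add: energy_eq_SUP[OF assms(1)])
  then show ?thesis
    using divide_ennreal[OF real_energy_nonneg[OF assms(1), of \<theta>], of 2] by simp
qed

lemma finite_energy_if_energy_finite:
  assumes ell: "elliptic a b r" and "energy r \<theta> < \<top>"
  shows "finite_energy \<theta>"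
proof -
  let ?S = "SUP F\<in>{F. finite F \<and> F \<subseteq> Z2_oriented}. ennreal (\<Sum>(x, y)\<in>F. r {x, y} * (\<theta> x y)\<^sup>2)"
  have "?S \<noteq> \<top>"
    using assms(2) unfolding energy_eq_SUP[OF ell] by (metis ennreal_numeral ennreal_neq_top ennreal_top_divide less_irrefl)
  then obtain s where s: "0 \<le> s" "?S = ennreal s" by (cases ?S) auto
  show ?thesis
  proof (rule finite_energy_bounded(1)[OF ell])
    fix F :: "(vertex \<times> vertex) set" assume F: "finite F" "F \<subseteq> Z2_oriented"
    then have "ennreal (\<Sum>(x, y)\<in>F. r {x, y} * (\<theta> x y)\<^sup>2) \<le> ?S" by (intro SUP_upper) auto
    then show "(\<Sum>(x, y)\<in>F. r {x, y} * (\<theta> x y)\<^sup>2) \<le> s" using s by simp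
  qed
qed

lemma eff_res_le:
  assumes "elliptic a b r" "unit_flow x0 y0 \<theta>" "finite_energy \<theta>"
  shows "eff_res r x0 y0 \<le> real_energy r \<theta> / 2"
proof -
  have "(INF \<theta>\<in>{\<theta>. unit_flow x0 y0 \<theta>}. energy r \<theta>) \<le> ennreal (real_energy r \<theta> / 2)"
    unfolding energy_eq_real_energy[OF assms(1,3), symmetric] using assms(2) by (intro INF_lower) simp
  then have "eff_res r x0 y0 \<le> enn2real (ennreal (real_energy r \<theta> / 2))"
    unfolding eff_res_def by (rule enn2real_mono) simp
  then show ?thesis using real_energy_nonneg[OF assms(1), of \<theta>] by simp
qed

section \<open>Finitely supported flows\<close>

text \<open>The unit flow along one edge. Concatenated along a path such flows give an admissible
  flow; around a square they give the test cycle for the plaquette law.\<close>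

definition edge_flow :: "vertex \<Rightarrow> vertex \<Rightarrow> vertex \<Rightarrow> vertex \<Rightarrow> real" where
  "edge_flow u w x y = of_bool (x = u \<and> y = w) - of_bool (x = w \<and> y = u)"

lemma edge_flow_anti: "edge_flow u w x y = - edge_flow u w y x"
  unfolding edge_flow_def by (simp add: conj_commute)

lemma sum_edge_flow:
  assumes "adj u w"
  shows "(\<Sum>y\<in>{y. adj x y}. edge_flow u w x y) = of_bool (x = u) - of_bool (x = w)"
proof -
  have *: "(\<Sum>y\<in>{y. adj x y}. of_bool (x = p \<and> y = q) :: real) = of_bool (x = p)" if "adj p q" for p q
  proof (cases "x = p")
    case True
    have "(\<Sum>y\<in>{y. adj x y}. of_bool (x = p \<and> y = q) :: real) = (\<Sum>y\<in>{y. adj x y}. if y = q then 1 else 0)"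
      using True by (intro sum.cong) auto
    with True that show ?thesis by simp
  qed simp
  show ?thesis unfolding edge_flow_def sum_subtractf
    using *[OF assms] *[of w u] assms adj_commute[of u w] by presburger
qed

lemma edge_flow_support: "{(x, y). edge_flow u w x y \<noteq> 0} \<subseteq> {(u, w), (w, u)}"
  by (auto simp: edge_flow_def)

lemma finite_energy_finite_support:
  assumes "finite {(x, y). \<gamma> x y \<noteq> 0}"
  shows "finite_energy \<gamma>"
  unfolding finite_energy_def
  by (rule finite_nonzero_values_imp_summable_on) (rule finite_subset[OF _ assms], auto)

lemma finite_support_flow_exists:
  "\<exists>\<gamma>. (\<forall>x y. \<gamma> x y = - \<gamma> y x) \<and> finite {(x, y). \<gamma> x y \<noteq> (0::real)} \<and>
     (\<forall>x. (\<Sum>y\<in>{y. adj x y}. \<gamma> x y) = of_bool (x = x0) - of_bool (x = z))" (is "?P z")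
proof -
  have step: "?P w" if "?P z" "adj z w" for z w
  proof -
    from that(1) obtain \<gamma> where \<gamma>: "\<forall>x y. \<gamma> x y = - \<gamma> y x" "finite {(x, y). \<gamma> x y \<noteq> (0::real)}"
      "\<forall>x. (\<Sum>y\<in>{y. adj x y}. \<gamma> x y) = of_bool (x = x0) - of_bool (x = z)" by blast
    define \<gamma>' where "\<gamma>' x y = \<gamma> x y + edge_flow z w x y" for x y
    have "\<gamma>' x y = - \<gamma>' y x" for x y
      unfolding \<gamma>'_def using \<gamma>(1) edge_flow_anti[of z w x y] by (metis minus_add_distrib)
    moreover have "finite {(x, y). \<gamma>' x y \<noteq> 0}"
    proof (rule finite_subset)
      show "{(x, y). \<gamma>' x y \<noteq> 0} \<subseteq> {(x, y). \<gamma> x y \<noteq> 0} \<union> {(x, y). edge_flow z w x y \<noteq> 0}"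
        unfolding \<gamma>'_def by auto
      show "finite ({(x, y). \<gamma> x y \<noteq> 0} \<union> {(x, y). edge_flow z w x y \<noteq> 0})"
        using \<gamma>(2) finite_subset[OF edge_flow_support] by simp
    qed
    moreover have "(\<Sum>y\<in>{y. adj x y}. \<gamma>' x y) = of_bool (x = x0) - of_bool (x = w)" for x
      unfolding \<gamma>'_def sum.distrib sum_edge_flow[OF that(2)] \<gamma>(3)[rule_format] by simp
    ultimately show "?P w" by blast
  qed
  have x0: "?P x0" by (rule exI[of _ "\<lambda>_ _. 0"]) simp
  obtain i j where ij: "x0 = (i, j)" by (cases x0)
  have horizontal: "?P (k, j)" for k
  proof (induction k rule: int_induct[where k = i])
    case base then show ?case using x0 ij by simp
  next
    case (step1 k) from step1(2) show ?case by (rule step) (simp add: adj_def)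
  next
    case (step2 k) from step2(2) show ?case by (rule step) (simp add: adj_def)
  qed
  have "?P (k, l)" for k l
  proof (induction l rule: int_induct[where k = j])
    case base then show ?case using horizontal by simp
  next
    case (step1 l) from step1(2) show ?case by (rule step) (simp add: adj_def)
  next
    case (step2 l) from step2(2) show ?case by (rule step) (simp add: adj_def)
  qed
  then show "?P z" by (cases z) simp
qed

lemma finite_energy_unit_flow_exists:
  assumes "x0 \<noteq> y0"
  shows "\<exists>\<theta>. unit_flow x0 y0 \<theta> \<and> finite_energy \<theta>"
  using finite_support_flow_exists[of x0 y0] finite_energy_finite_support
  unfolding unit_flow_iff[OF assms] by blast

text \<open>\<open>enn2real\<close> sends infinity to 0, so the real value represents the infimum
  only because some unit flow has finite energy.\<close>

lemma INF_energy_eq: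
  assumes ell: "elliptic a b r" and neq: "x0 \<noteq> y0"
  shows "(INF \<theta>\<in>{\<theta>. unit_flow x0 y0 \<theta>}. energy r \<theta>) = ennreal (eff_res r x0 y0)"
proof -
  obtain \<theta> where \<theta>: "unit_flow x0 y0 \<theta>" "finite_energy \<theta>"
    using finite_energy_unit_flow_exists[OF neq] by blast
  have "(INF \<theta>\<in>{\<theta>. unit_flow x0 y0 \<theta>}. energy r \<theta>) \<le> energy r \<theta>"
    using \<theta>(1) by (intro INF_lower) simp
  then have "(INF \<theta>\<in>{\<theta>. unit_flow x0 y0 \<theta>}. energy r \<theta>) < \<top>"
    unfolding energy_eq_real_energy[OF ell \<theta>(2)] using ennreal_less_top le_less_trans by blast
  then show ?thesis unfolding eff_res_def by simp
qed

lemma parallelogram: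
  assumes ell: "elliptic a b r" and fin: "finite_energy \<theta>" "finite_energy \<phi>"
  defines "s \<equiv> (\<lambda>x y. (\<theta> x y + \<phi> x y) / 2)" and "d \<equiv> (\<lambda>x y. (\<theta> x y - \<phi> x y) / 2)"
  shows "finite_energy s" "finite_energy d"
    "real_energy r s + real_energy r d = (real_energy r \<theta> + real_energy r \<phi>) / 2"
proof -
  have dom: "(\<lambda>p. (case p of (x, y) \<Rightarrow> (\<theta> x y)\<^sup>2) + (case p of (x, y) \<Rightarrow> (\<phi> x y)\<^sup>2)) summable_on Z2_oriented"
    using fin unfolding finite_energy_def by (rule summable_on_add)
  have *: "((p + q) / 2)\<^sup>2 \<le> p\<^sup>2 + q\<^sup>2" "((p - q) / 2)\<^sup>2 \<le> p\<^sup>2 + q\<^sup>2" for p q :: real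
    using sum_squares_bound[of p q] sum_squares_bound[of p "- q"]
    by (simp_all add: power2_eq_square field_simps)
  show s: "finite_energy s" and d: "finite_energy d"
    unfolding finite_energy_def
    by (rule summable_on_comparison_test[OF dom]; auto simp: s_def d_def *)+
  let ?e = "\<lambda>\<psi> (x, y). r {x, y} * (\<psi> x y)\<^sup>2 :: real"
  have "real_energy r s + real_energy r d = infsum (\<lambda>p. ?e s p + ?e d p) Z2_oriented"
    unfolding real_energy_def using s d
    by (intro infsum_add[symmetric]) (auto simp: weighted_summable_iff[OF ell])
  also have "\<dots> = infsum (\<lambda>p. (?e \<theta> p + ?e \<phi> p) * (1 / 2)) Z2_oriented"
    by (intro infsum_cong) (auto simp: s_def d_def power2_eq_square field_simps)
  also have "\<dots> = infsum (\<lambda>p. ?e \<theta> p + ?e \<phi> p) Z2_oriented * (1 / 2)"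
    using fin by (intro infsum_cmult_left summable_on_add) (auto simp: weighted_summable_iff[OF ell])
  also have "infsum (\<lambda>p. ?e \<theta> p + ?e \<phi> p) Z2_oriented = real_energy r \<theta> + real_energy r \<phi>"
    unfolding real_energy_def using fin by (intro infsum_add) (auto simp: weighted_summable_iff[OF ell])
  finally show "real_energy r s + real_energy r d = (real_energy r \<theta> + real_energy r \<phi>) / 2" by simp
qed

text \<open>The parallelogram law makes a minimizing sequence converge pointwise.\<close>

lemma minimizer_exists:
  assumes ell: "elliptic a b r" and neq: "x0 \<noteq> y0"
  shows "\<exists>\<theta>. unit_flow x0 y0 \<theta> \<and> finite_energy \<theta> \<and> real_energy r \<theta> / 2 = eff_res r x0 y0"
proof -
  let ?R = "eff_res r x0 y0"
  define t where "t = (\<lambda>n. 1 / real (Suc n))"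
  have "\<exists>\<phi>. unit_flow x0 y0 \<phi> \<and> finite_energy \<phi> \<and> real_energy r \<phi> / 2 < ?R + t n" for n
  proof -
    have "0 \<le> ?R" by (simp add: eff_res_def)
    moreover have "0 < t n" by (simp add: t_def)
    ultimately have "(INF \<theta>\<in>{\<theta>. unit_flow x0 y0 \<theta>}. energy r \<theta>) < ennreal (?R + t n)"
      unfolding INF_energy_eq[OF ell neq] by (intro ennreal_lessI) auto
    then obtain \<phi> where \<phi>: "unit_flow x0 y0 \<phi>" "energy r \<phi> < ennreal (?R + t n)"
      by (auto simp: INF_less_iff)
    have fin: "finite_energy \<phi>"
      using \<phi>(2) by (intro finite_energy_if_energy_finite[OF ell]) (auto intro: less_trans)
    with \<phi> show ?thesis
      using real_energy_nonneg[OF ell, of \<phi>] by (auto simp: energy_eq_real_energy[OF ell] ennreal_less_iff)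
  qed
  then obtain \<phi> where \<phi>: "\<And>n. unit_flow x0 y0 (\<phi> n)" "\<And>n. finite_energy (\<phi> n)"
    "\<And>n. real_energy r (\<phi> n) / 2 < ?R + t n" by metis
  have a: "0 < a" using ell by (simp add: elliptic_def)
  have anti: "\<phi> n x y = - \<phi> n y x" if "adj x y" for n x y
    using \<phi>(1)[of n] that unfolding unit_flow_iff[OF neq] by blast
  have div: "(\<Sum>y\<in>{y. adj x y}. \<phi> n x y) = of_bool (x = x0) - of_bool (x = y0)" for n x
    using \<phi>(1)[of n] unfolding unit_flow_iff[OF neq] by blast
  \<comment> \<open>The midpoint \<open>s\<close> of two almost optimal flows is again a unit flow,
    so its energy is at least the infimum; the parallelogram law then leaves only
    \<open>t m + t n\<close> for the half-difference \<open>d\<close>.\<close>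
  have diff: "a * (\<phi> m x y - \<phi> n x y)\<^sup>2 \<le> 4 * (t m + t n)" if "adj x y" for m n x y
  proof -
    define s where "s = (\<lambda>x y. (\<phi> m x y + \<phi> n x y) / 2)"
    define d where "d = (\<lambda>x y. (\<phi> m x y - \<phi> n x y) / 2)"
    note par = parallelogram[OF ell \<phi>(2)[of m] \<phi>(2)[of n], folded s_def d_def]
    have "unit_flow x0 y0 s"
      unfolding unit_flow_iff[OF neq]
    proof (intro conjI allI impI)
      fix x y assume "adj x y"
      then show "s x y = - s y x" using anti[of x y m] anti[of x y n] by (simp add: s_def field_simps)
    next
      fix x show "(\<Sum>y\<in>{y. adj x y}. s x y) = of_bool (x = x0) - of_bool (x = y0)"
        unfolding s_def sum_divide_distrib[symmetric] sum.distrib div by simp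
    qed
    from eff_res_le[OF ell this par(1)] have "?R \<le> real_energy r s / 2" .
    with par(3) \<phi>(3)[of m] \<phi>(3)[of n] have "real_energy r d \<le> t m + t n" by (simp add: field_simps)
    moreover have "r {x, y} * (d x y)\<^sup>2 \<le> real_energy r d"
      using partial_sum_le_real_energy[OF ell par(2), of "{(x, y)}"] that by (simp add: Z2_oriented_def)
    moreover have "a * (d x y)\<^sup>2 \<le> r {x, y} * (d x y)\<^sup>2"
      using ellipticD[OF ell that] by (intro mult_right_mono) auto
    ultimately have "a * (d x y)\<^sup>2 \<le> t m + t n" by linarith
    then show ?thesis by (simp add: d_def power_divide)
  qed
  have t0: "t \<longlonglongrightarrow> 0" unfolding t_def by (rule LIMSEQ_Suc[OF lim_1_over_n])
  define \<theta> where "\<theta> x y = lim (\<lambda>n. \<phi> n x y)" for x y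
  have lim: "(\<lambda>n. \<phi> n x y) \<longlonglongrightarrow> \<theta> x y" if adj: "adj x y" for x y
  proof -
    have "Cauchy (\<lambda>n. \<phi> n x y)"
    proof (rule CauchyI)
      fix e :: real assume "0 < e"
      then have "0 < a * e\<^sup>2 / 8" using a by simp
      then have "eventually (\<lambda>n. t n < a * e\<^sup>2 / 8) sequentially" by (rule order_tendstoD(2)[OF t0])
      then obtain N where N: "\<And>n. n \<ge> N \<Longrightarrow> t n < a * e\<^sup>2 / 8" by (auto simp: eventually_sequentially)
      have "norm (\<phi> m x y - \<phi> n x y) < e" if mn: "m \<ge> N" "n \<ge> N" for m n
      proof -
        have "a * (\<phi> m x y - \<phi> n x y)\<^sup>2 < a * e\<^sup>2"
        proof (rule le_less_trans[OF diff[OF adj]])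
          have "t m < c / 8 \<Longrightarrow> t n < c / 8 \<Longrightarrow> 4 * (t m + t n) < c" for c by simp
          then show "4 * (t m + t n) < a * e\<^sup>2" using N[OF mn(1)] N[OF mn(2)] .
        qed
        then have "(\<phi> m x y - \<phi> n x y)\<^sup>2 < e\<^sup>2" using a by simp
        then show ?thesis using \<open>0 < e\<close> power2_less_imp_less[of "\<bar>\<phi> m x y - \<phi> n x y\<bar>" e] by simp
      qed
      then show "\<exists>M. \<forall>m\<ge>M. \<forall>n\<ge>M. norm (\<phi> m x y - \<phi> n x y) < e" by blast
    qed
    then show ?thesis unfolding \<theta>_def by (simp add: Cauchy_convergent_iff convergent_LIMSEQ_iff)
  qed
  have flow: "unit_flow x0 y0 \<theta>"
    unfolding unit_flow_iff[OF neq]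
  proof (intro conjI allI impI)
    fix x y assume adj: "adj x y"
    have "(\<lambda>n. - \<phi> n y x) \<longlonglongrightarrow> - \<theta> y x" using adj by (intro tendsto_minus lim) (simp add: adj_commute)
    then have "(\<lambda>n. \<phi> n x y) \<longlonglongrightarrow> - \<theta> y x" using anti[OF adj] by simp
    with lim[OF adj] show "\<theta> x y = - \<theta> y x" by (rule LIMSEQ_unique)
  next
    fix x
    have "(\<lambda>n. \<Sum>y\<in>{y. adj x y}. \<phi> n x y) \<longlonglongrightarrow> (\<Sum>y\<in>{y. adj x y}. \<theta> x y)"
      by (intro tendsto_sum lim) simp
    then show "(\<Sum>y\<in>{y. adj x y}. \<theta> x y) = of_bool (x = x0) - of_bool (x = y0)"
      unfolding div by (simp add: LIMSEQ_const_iff)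
  qed
  \<comment> \<open>Lower semicontinuity: only pointwise convergence is known, so the energy bound
    is passed to the limit on finite sets of edges.\<close>
  have "(\<Sum>(x, y)\<in>F. r {x, y} * (\<theta> x y)\<^sup>2) \<le> 2 * ?R" if F: "finite F" "F \<subseteq> Z2_oriented" for F
  proof (rule LIMSEQ_le)
    show "(\<lambda>n. \<Sum>(x, y)\<in>F. r {x, y} * (\<phi> n x y)\<^sup>2) \<longlonglongrightarrow> (\<Sum>(x, y)\<in>F. r {x, y} * (\<theta> x y)\<^sup>2)"
      using F(2) by (auto simp: case_prod_beta Z2_oriented_def
          intro!: tendsto_sum tendsto_mult tendsto_power lim)
    show "(\<lambda>n. 2 * (?R + t n)) \<longlonglongrightarrow> 2 * ?R"
      using tendsto_mult[OF tendsto_const tendsto_add[OF tendsto_const t0], of 2 ?R] by simp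
    have "(\<Sum>(x, y)\<in>F. r {x, y} * (\<phi> n x y)\<^sup>2) \<le> 2 * (?R + t n)" for n
      using partial_sum_le_real_energy[OF ell \<phi>(2)[of n] F] \<phi>(3)[of n] by argo
    then show "\<exists>N. \<forall>n\<ge>N. (\<Sum>(x, y)\<in>F. r {x, y} * (\<phi> n x y)\<^sup>2) \<le> 2 * (?R + t n)" by blast
  qed
  from finite_energy_bounded[OF ell this] have "finite_energy \<theta>" "real_energy r \<theta> \<le> 2 * ?R" by auto
  with eff_res_le[OF ell flow] flow show ?thesis by (intro exI[of _ \<theta>]) auto
qed

section \<open>The potential of the minimal flow\<close>

lemma linear_term_zero:
  fixes B G :: real
  assumes "\<And>t. 0 \<le> 2 * t * B + t\<^sup>2 * G" "0 \<le> G"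
  shows "B = 0"
proof (rule ccontr)
  assume "B \<noteq> 0"
  \<comment> \<open>A small step against the sign of \<open>B\<close>; the denominator
    \<open>G + 1\<close> in place of \<open>G\<close> covers \<open>G = 0\<close>.\<close>
  have "2 * (- B / (G + 1)) * B + (- B / (G + 1))\<^sup>2 * G = - (B / (G + 1))\<^sup>2 * (G + 2)"
    using assms(2) by (simp add: power2_eq_square divide_simps) (simp add: algebra_simps)
  also have "\<dots> < 0" using \<open>B \<noteq> 0\<close> assms(2) by (intro mult_neg_pos) auto
  finally show False using assms(1)[of "- B / (G + 1)"] by linarith
qed

text \<open>First variation: \<gamma> is divergence free, so every
  \<open>\<theta> + t * \<gamma>\<close> is admissible and its energy is a quadratic in
  \<open>t\<close> with minimum at \<open>t = 0\<close>.\<close>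

lemma minimizer_orthogonal:
  assumes ell: "elliptic a b r" and neq: "x0 \<noteq> y0"
    and \<theta>: "unit_flow x0 y0 \<theta>" "finite_energy \<theta>" "real_energy r \<theta> / 2 = eff_res r x0 y0"
    and \<gamma>: "\<And>x y. \<gamma> x y = - \<gamma> y x" "finite {(x, y). \<gamma> x y \<noteq> (0::real)}"
      "\<And>x. (\<Sum>y\<in>{y. adj x y}. \<gamma> x y) = 0"
  shows "(\<Sum>\<^sub>\<infinity>(x, y)\<in>Z2_oriented. r {x, y} * \<theta> x y * \<gamma> x y) = 0" (is "?B = 0")
proof (rule linear_term_zero)
  have fin\<gamma>: "finite_energy \<gamma>" by (rule finite_energy_finite_support[OF \<gamma>(2)])
  have e\<theta>: "((\<lambda>(x, y). r {x, y} * (\<theta> x y)\<^sup>2) has_sum real_energy r \<theta>) Z2_oriented"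
    unfolding real_energy_def using \<theta>(2) by (intro has_sum_infsum) (simp add: weighted_summable_iff[OF ell])
  have e\<gamma>: "((\<lambda>(x, y). r {x, y} * (\<gamma> x y)\<^sup>2) has_sum real_energy r \<gamma>) Z2_oriented"
    unfolding real_energy_def using fin\<gamma> by (intro has_sum_infsum) (simp add: weighted_summable_iff[OF ell])
  have cross: "((\<lambda>(x, y). r {x, y} * \<theta> x y * \<gamma> x y) has_sum ?B) Z2_oriented"
    by (intro has_sum_infsum finite_nonzero_values_imp_summable_on finite_subset[OF _ \<gamma>(2)]) auto
  show "0 \<le> real_energy r \<gamma>" by (rule real_energy_nonneg[OF ell])
  fix t :: real
  define \<psi> where "\<psi> x y = \<theta> x y + t * \<gamma> x y" for x y
  have "((\<lambda>p. (case p of (x, y) \<Rightarrow> r {x, y} * (\<theta> x y)\<^sup>2) +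
      (2 * t * (case p of (x, y) \<Rightarrow> r {x, y} * \<theta> x y * \<gamma> x y) +
       t\<^sup>2 * (case p of (x, y) \<Rightarrow> r {x, y} * (\<gamma> x y)\<^sup>2)))
     has_sum (real_energy r \<theta> + (2 * t * ?B + t\<^sup>2 * real_energy r \<gamma>))) Z2_oriented"
    by (intro has_sum_add has_sum_cmult_right e\<theta> e\<gamma> cross)
  also have "(\<lambda>p. (case p of (x, y) \<Rightarrow> r {x, y} * (\<theta> x y)\<^sup>2) +
      (2 * t * (case p of (x, y) \<Rightarrow> r {x, y} * \<theta> x y * \<gamma> x y) +
       t\<^sup>2 * (case p of (x, y) \<Rightarrow> r {x, y} * (\<gamma> x y)\<^sup>2))) = (\<lambda>(x, y). r {x, y} * (\<psi> x y)\<^sup>2)"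
    by (auto simp: fun_eq_iff \<psi>_def power2_eq_square algebra_simps)
  finally have sum\<psi>: "((\<lambda>(x, y). r {x, y} * (\<psi> x y)\<^sup>2) has_sum
      (real_energy r \<theta> + (2 * t * ?B + t\<^sup>2 * real_energy r \<gamma>))) Z2_oriented" .
  then have "finite_energy \<psi>"
    using has_sum_imp_summable weighted_summable_iff[OF ell] by blast
  moreover have "unit_flow x0 y0 \<psi>"
    unfolding unit_flow_iff[OF neq]
  proof (intro conjI allI impI)
    fix x y assume "adj x y"
    then have "\<theta> x y = - \<theta> y x" using \<theta>(1) unfolding unit_flow_iff[OF neq] by blast
    then show "\<psi> x y = - \<psi> y x" using \<gamma>(1)[of x y] by (simp add: \<psi>_def)
  next
    fix x
    have "(\<Sum>y\<in>{y. adj x y}. \<theta> x y) = of_bool (x = x0) - of_bool (x = y0)"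
      using \<theta>(1) unfolding unit_flow_iff[OF neq] by blast
    then show "(\<Sum>y\<in>{y. adj x y}. \<psi> x y) = of_bool (x = x0) - of_bool (x = y0)"
      unfolding \<psi>_def sum.distrib sum_distrib_left[symmetric] \<gamma>(3) by simp
  qed
  ultimately have "eff_res r x0 y0 \<le> real_energy r \<psi> / 2" by (intro eff_res_le[OF ell])
  moreover have "real_energy r \<psi> = real_energy r \<theta> + (2 * t * ?B + t\<^sup>2 * real_energy r \<gamma>)"
    unfolding real_energy_def[of r \<psi>] by (rule infsumI[OF sum\<psi>])
  ultimately show "0 \<le> 2 * t * ?B + t\<^sup>2 * real_energy r \<gamma>" using \<theta>(3) by simp
qed

lemma edge_flow_pairing:
  fixes g :: "vertex \<Rightarrow> vertex \<Rightarrow> real"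
  assumes "adj u w" "g w u = - g u w"
  shows "((\<lambda>(x, y). g x y * edge_flow u w x y) has_sum (2 * g u w)) Z2_oriented"
proof -
  have "((\<lambda>(x, y). g x y * edge_flow u w x y) has_sum (2 * g u w)) {(u, w), (w, u)}"
    using adj_imp_neq[OF assms(1)] assms(2)
    by (intro has_sum_finiteI) (auto simp: edge_flow_def)
  moreover have "{(u, w), (w, u)} \<subseteq> Z2_oriented"
    using assms(1) adj_commute[of u w] by (simp add: Z2_oriented_def)
  moreover have "(case p of (x, y) \<Rightarrow> g x y * edge_flow u w x y) = 0" if "p \<notin> {(u, w), (w, u)}" for p
    using that edge_flow_support[of u w] by (cases p) auto
  ultimately show ?thesis
    by (subst has_sum_cong_neutral[of "{(u, w), (w, u)}" Z2_oriented]) auto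
qed

text \<open>Kirchhoff's cycle law, obtained by testing minimality with the unit circulation around
  the four edges.\<close>

lemma plaquette_law:
  assumes ell: "elliptic a b r" and neq: "x0 \<noteq> y0"
    and \<theta>: "unit_flow x0 y0 \<theta>" "finite_energy \<theta>" "real_energy r \<theta> / 2 = eff_res r x0 y0"
  defines "g \<equiv> (\<lambda>x y. r {x, y} * \<theta> x y)"
  assumes adj: "adj p q" "adj q s" "adj s t" "adj t p"
  shows "g p q + g q s + g s t + g t p = 0"
proof -
  have anti: "g y x = - g x y" if "adj x y" for x y
  proof -
    have "\<theta> x y = - \<theta> y x" using \<theta>(1) that unfolding unit_flow_iff[OF neq] by blast
    then show ?thesis by (simp add: g_def insert_commute)
  qed
  define \<gamma> where "\<gamma> x y = edge_flow p q x y + edge_flow q s x y + edge_flow s t x y + edge_flow t p x y" for x y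
  have "((\<lambda>z. (case z of (x, y) \<Rightarrow> g x y * edge_flow p q x y) + (case z of (x, y) \<Rightarrow> g x y * edge_flow q s x y)
      + (case z of (x, y) \<Rightarrow> g x y * edge_flow s t x y) + (case z of (x, y) \<Rightarrow> g x y * edge_flow t p x y))
      has_sum (2 * g p q + 2 * g q s + 2 * g s t + 2 * g t p)) Z2_oriented"
    using adj by (intro has_sum_add edge_flow_pairing anti)
  also have "(\<lambda>z. (case z of (x, y) \<Rightarrow> g x y * edge_flow p q x y) + (case z of (x, y) \<Rightarrow> g x y * edge_flow q s x y)
      + (case z of (x, y) \<Rightarrow> g x y * edge_flow s t x y) + (case z of (x, y) \<Rightarrow> g x y * edge_flow t p x y))
      = (\<lambda>(x, y). r {x, y} * \<theta> x y * \<gamma> x y)"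
    by (auto simp: fun_eq_iff \<gamma>_def g_def distrib_left)
  finally have "(\<Sum>\<^sub>\<infinity>(x, y)\<in>Z2_oriented. r {x, y} * \<theta> x y * \<gamma> x y) =
      2 * g p q + 2 * g q s + 2 * g s t + 2 * g t p" by (rule infsumI)
  moreover have "(\<Sum>\<^sub>\<infinity>(x, y)\<in>Z2_oriented. r {x, y} * \<theta> x y * \<gamma> x y) = 0"
  proof (rule minimizer_orthogonal[OF ell neq \<theta>])
    show "\<gamma> x y = - \<gamma> y x" for x y
      unfolding \<gamma>_def using edge_flow_anti[of p q x y] edge_flow_anti[of q s x y]
        edge_flow_anti[of s t x y] edge_flow_anti[of t p x y] by linarith
    show "finite {(x, y). \<gamma> x y \<noteq> 0}"
    proof (rule finite_subset)
      show "{(x, y). \<gamma> x y \<noteq> 0} \<subseteq> {(x, y). edge_flow p q x y \<noteq> 0} \<union> {(x, y). edge_flow q s x y \<noteq> 0}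
        \<union> {(x, y). edge_flow s t x y \<noteq> 0} \<union> {(x, y). edge_flow t p x y \<noteq> 0}"
        by (auto simp: \<gamma>_def)
    qed (simp add: finite_subset[OF edge_flow_support])
    show "(\<Sum>y\<in>{y. adj x y}. \<gamma> x y) = 0" for x
      unfolding \<gamma>_def sum.distrib using adj by (simp add: sum_edge_flow)
  qed
  ultimately show ?thesis by linarith
qed

lemma int_primitive_exists:
  fixes f :: "int \<Rightarrow> real"
  shows "\<exists>F. F 0 = 0 \<and> (\<forall>i. F (i + 1) - F i = f i)"
proof -
  define F where "F i = (if 0 \<le> i then \<Sum>k\<in>{0..<i}. f k else - (\<Sum>k\<in>{i..<0}. f k))" for i
  have "F (i + 1) - F i = f i" for i
  proof -
    consider "0 \<le> i" | "i = - 1" | "i < - 1" by linarith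
    then show ?thesis
    proof cases
      case 1
      then have "{0..<i + 1} = insert i {0..<i}" by auto
      with 1 show ?thesis by (simp add: F_def)
    next
      case 2
      then have "{i..<0} = {i}" by auto
      with 2 show ?thesis by (simp add: F_def)
    next
      case 3
      then have "{i..<0} = insert i {i + 1..<0}" by auto
      with 3 show ?thesis by (simp add: F_def)
    qed
  qed
  moreover have "F 0 = 0" by (simp add: F_def)
  ultimately show ?thesis by blast
qed

text \<open>\<open>g\<close> is integrated along the horizontal axis and then along each column.
  Vertical increments are correct by construction; the plaquette relation carries the horizontal
  ones from each row to the next.\<close>

lemma potential_exists:
  fixes g :: "vertex \<Rightarrow> vertex \<Rightarrow> real"
  assumes anti: "\<And>x y. adj x y \<Longrightarrow> g y x = - g x y"
    and cycle: "\<And>p q s t. adj p q \<Longrightarrow> adj q s \<Longrightarrow> adj s t \<Longrightarrow> adj t p \<Longrightarrow> g p q + g q s + g s t + g t p = 0"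
  shows "\<exists>h. \<forall>x y. adj x y \<longrightarrow> h x - h y = g x y"
proof -
  obtain F where F: "\<And>i. F (i + 1) - F i = - g (i, 0) (i + 1, 0)"
    using int_primitive_exists[of "\<lambda>i. - g (i, 0) (i + 1, 0)"] by blast
  have "\<forall>i. \<exists>G. G 0 = 0 \<and> (\<forall>j. G (j + 1) - G j = - g (i, j) (i, j + 1))"
    using int_primitive_exists[of "\<lambda>j. - g (_, j) (_, j + 1)"] by blast
  then obtain G where G: "\<And>i. G i 0 = 0" "\<And>i j. G i (j + 1) - G i j = - g (i, j) (i, j + 1)"
    by metis
  define h where "h x = F (fst x) + G (fst x) (snd x)" for x
  have vert: "h (i, j) - h (i, j + 1) = g (i, j) (i, j + 1)" for i j
    using G(2)[of i j] by (simp add: h_def)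
  have horiz: "h (i, j) - h (i + 1, j) = g (i, j) (i + 1, j)" for i j
  proof -
    define D where "D j = h (i, j) - h (i + 1, j) - g (i, j) (i + 1, j)" for j
    have step: "D (j + 1) = D j" for j
    proof -
      have "g (i, j) (i + 1, j) + g (i + 1, j) (i + 1, j + 1) + g (i + 1, j + 1) (i, j + 1)
          + g (i, j + 1) (i, j) = 0"
        by (rule cycle) (auto simp: adj_def)
      moreover have "g (i + 1, j + 1) (i, j + 1) = - g (i, j + 1) (i + 1, j + 1)"
        "g (i, j + 1) (i, j) = - g (i, j) (i, j + 1)"
        by (rule anti; simp add: adj_def)+
      ultimately show ?thesis using vert[of i j] vert[of "i + 1" j] by (simp add: D_def)
    qed
    have "D j = 0"
    proof (induction j rule: int_induct[where k = 0])
      case base show ?case using F[of i] G(1) by (simp add: D_def h_def)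
    next
      case (step1 j) then show ?case using step[of j] by simp
    next
      case (step2 j) then show ?case using step[of "j - 1"] by simp
    qed
    then show ?thesis by (simp add: D_def)
  qed
  have "h x - h y = g x y" if "adj x y" for x y
  proof -
    obtain i j where x: "x = (i, j)" by (cases x)
    have "y \<in> {y. adj (i, j) y}" using that x by simp
    then consider "y = (i + 1, j)" | "y = (i - 1, j)" | "y = (i, j + 1)" | "y = (i, j - 1)"
      unfolding neighbours_eq by auto
    then show ?thesis
    proof cases
      case 1 then show ?thesis using horiz[of i j] x by simp
    next
      case 2 then show ?thesis using horiz[of "i - 1" j] anti[of x y] x that by simp
    next
      case 3 then show ?thesis using vert[of i j] x by simp
    next
      case 4 then show ?thesis using vert[of i "j - 1"] anti[of x y] x that by simp
    qed
  qed
  then show ?thesis by blast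
qed

lemma unit_current_exists:
  assumes ell: "elliptic a b r" and neq: "x0 \<noteq> y0"
  shows "\<exists>\<theta> h. unit_current a b r x0 y0 \<theta> h \<and> real_energy r \<theta> / 2 = eff_res r x0 y0"
proof -
  obtain \<theta> where \<theta>: "unit_flow x0 y0 \<theta>" "finite_energy \<theta>" "real_energy r \<theta> / 2 = eff_res r x0 y0"
    using minimizer_exists[OF assms] by blast
  have anti: "r {y, x} * \<theta> y x = - (r {x, y} * \<theta> x y)" if "adj x y" for x y
  proof -
    have "\<theta> x y = - \<theta> y x" using \<theta>(1) that unfolding unit_flow_iff[OF neq] by blast
    then show ?thesis by (simp add: insert_commute)
  qed
  obtain h where "\<forall>x y. adj x y \<longrightarrow> h x - h y = r {x, y} * \<theta> x y"
    using potential_exists[of "\<lambda>x y. r {x, y} * \<theta> x y", OF anti plaquette_law[OF ell neq \<theta>]] by blast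
  then have "unit_current a b r x0 y0 \<theta> h"
    using \<theta> neq ell unfolding unit_current_def elliptic_def finite_energy_def by blast
  with \<theta>(3) show ?thesis by blast
qed

section \<open>Fourth powers of the current\<close>

context unit_current
begin

text \<open>Fourth powers are at most the largest squared current times the energy. Within distance
  \<open>K\<close> of a pole the current is merely bounded but the energy is
  \<open>O(harm K)\<close>; elsewhere the total energy is used and the current is
  \<open>O(1 / harm K)\<close>.\<close>

lemma quartic_sum_le:
  assumes F: "finite F" "F \<subseteq> Z2_oriented" and K: "1 \<le> K"
  shows "(\<Sum>(x, y)\<in>F. (\<theta> x y)^4) \<le>
     2 * (324 * b / a)\<^sup>2 * (648 * b / a) * (1 + harm K) +
     (256 * b / a)\<^sup>2 * (324 * b / a) * ((1 + harm (nat (sup_norm (y0 - x0)))) / (harm K)\<^sup>2)"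
proof -
  have b: "0 \<le> b" using a_pos a_le_b by simp
  have hK: "0 < (harm K :: real)" using K by (intro harm_pos) auto
  have quartic: "(\<Sum>(x, y)\<in>G. (\<theta> x y)^4) \<le> c\<^sup>2 * (T / a)"
    if G: "G \<subseteq> Z2_oriented" and c: "\<And>x y. (x, y) \<in> G \<Longrightarrow> \<bar>\<theta> x y\<bar> \<le> c"
      and T: "a * (\<Sum>(x, y)\<in>G. (\<theta> x y)\<^sup>2) \<le> T" for G c T
  proof -
    have "(\<Sum>(x, y)\<in>G. (\<theta> x y)^4) \<le> (\<Sum>(x, y)\<in>G. c\<^sup>2 * (\<theta> x y)\<^sup>2)"
    proof (intro sum_mono, clarify)
      fix x y assume "((x, y) :: vertex \<times> vertex) \<in> G"
      from c[OF this] have "\<bar>\<theta> x y\<bar>\<^sup>2 \<le> c\<^sup>2" by (intro power_mono) auto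
      then have "(\<theta> x y)\<^sup>2 * (\<theta> x y)\<^sup>2 \<le> c\<^sup>2 * (\<theta> x y)\<^sup>2" by (intro mult_right_mono) auto
      then show "(\<theta> x y)^4 \<le> c\<^sup>2 * (\<theta> x y)\<^sup>2" by (simp flip: power_add)
    qed
    also have "\<dots> = c\<^sup>2 * (\<Sum>(x, y)\<in>G. (\<theta> x y)\<^sup>2)" by (simp add: sum_distrib_left case_prod_beta)
    also have "\<dots> \<le> c\<^sup>2 * (T / a)" using T a_pos by (intro mult_left_mono) (auto simp: field_simps)
    finally show ?thesis .
  qed
  define F1 where "F1 = {p \<in> F. sup_norm (fst p - x0) < int K}"
  define F2 where "F2 = {p \<in> F. sup_norm (fst p - y0) < int K}"
  define F3 where "F3 = {p \<in> F. int K \<le> sup_norm (fst p - x0) \<and> int K \<le> sup_norm (fst p - y0)}"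
  have sub: "F1 \<subseteq> Z2_oriented" "F2 \<subseteq> Z2_oriented" "F3 \<subseteq> Z2_oriented"
    using F(2) by (auto simp: F1_def F2_def F3_def)
  have fin: "finite F1" "finite F2" "finite F3" using F(1) by (auto simp: F1_def F2_def F3_def)
  \<comment> \<open>At distance 1 the potential bound is
    \<open>162 * b * (1 + harm 1) = 324 * b\<close>.\<close>
  have bounded: "\<bar>\<theta> x y\<bar> \<le> 324 * b / a" if "(x, y) \<in> Z2_oriented" for x y
  proof -
    have adj: "adj x y" using that by (simp add: Z2_oriented_def)
    then have "sup_norm (y - x) = 1" by (auto simp: sup_norm_def adj_def)
    with potential_diff_le[of x y] have "\<bar>h x - h y\<bar> \<le> 324 * b" by (simp add: harm_def)
    then have "\<bar>h x - h y\<bar> / a \<le> 324 * b / a" using a_pos by (intro divide_right_mono) auto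
    with abs_current_le[OF adj] show ?thesis by linarith
  qed
  have far: "\<bar>\<theta> x y\<bar> \<le> 256 * b / a / harm K" if "(x, y) \<in> F3" for x y
  proof -
    have adj: "adj x y" using that sub(3) by (auto simp: Z2_oriented_def)
    have "\<bar>h x - h y\<bar> * harm K \<le> 256 * b"
      using that by (intro potential_step_le[OF adj]) (auto simp: F3_def)
    then have "\<bar>h x - h y\<bar> / a \<le> 256 * b / harm K / a"
      using hK a_pos by (intro divide_right_mono) (auto simp: field_simps)
    with abs_current_le[OF adj] show ?thesis by (simp add: field_simps)
  qed
  have S1: "(\<Sum>(x, y)\<in>F1. (\<theta> x y)^4) \<le> (324 * b / a)\<^sup>2 * (648 * b * (1 + harm K) / a)"
  proof (rule quartic[OF sub(1)])
    show "\<bar>\<theta> x y\<bar> \<le> 324 * b / a" if "(x, y) \<in> F1" for x y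
      using that sub(1) by (intro bounded) auto
    show "a * (\<Sum>(x, y)\<in>F1. (\<theta> x y)\<^sup>2) \<le> 648 * b * (1 + harm K)"
      by (rule energy_in_ball[OF fin(1) sub(1), where c = x0]) (simp add: F1_def)
  qed
  have S2: "(\<Sum>(x, y)\<in>F2. (\<theta> x y)^4) \<le> (324 * b / a)\<^sup>2 * (648 * b * (1 + harm K) / a)"
  proof (rule quartic[OF sub(2)])
    show "\<bar>\<theta> x y\<bar> \<le> 324 * b / a" if "(x, y) \<in> F2" for x y
      using that sub(2) by (intro bounded) auto
    show "a * (\<Sum>(x, y)\<in>F2. (\<theta> x y)\<^sup>2) \<le> 648 * b * (1 + harm K)"
      by (rule energy_in_ball[OF fin(2) sub(2), where c = y0]) (simp add: F2_def)
  qed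
  have S3: "(\<Sum>(x, y)\<in>F3. (\<theta> x y)^4) \<le>
      (256 * b / a / harm K)\<^sup>2 * (324 * b * (1 + harm (nat (sup_norm (y0 - x0)))) / a)"
  proof (rule quartic[OF sub(3) far])
    have "h x0 - h y0 \<le> 162 * b * (1 + harm (nat (sup_norm (y0 - x0))))"
      using potential_diff_le[of x0 y0] by linarith
    then show "a * (\<Sum>(x, y)\<in>F3. (\<theta> x y)\<^sup>2) \<le> 324 * b * (1 + harm (nat (sup_norm (y0 - x0))))"
      using total_energy[OF fin(3) sub(3)] by argo
  qed
  \<comment> \<open>The balls around the two poles may overlap, so only subadditivity is
    available.\<close>
  have sum_Un_le: "sum q (A \<union> B) \<le> sum q A + sum q B"
    if "finite A" "finite B" "\<And>p. 0 \<le> q p" for q :: "vertex \<times> vertex \<Rightarrow> real" and A B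
    using sum.union_inter[OF that(1,2), of q] sum_nonneg[of "A \<inter> B" q] that(3) by auto
  have "F = F1 \<union> F2 \<union> F3" by (auto simp: F1_def F2_def F3_def)
  then have le: "(\<Sum>(x, y)\<in>F. (\<theta> x y)^4) \<le> (\<Sum>(x, y)\<in>F1 \<union> F2. (\<theta> x y)^4) + (\<Sum>(x, y)\<in>F3. (\<theta> x y)^4)"
    by (simp, intro sum_Un_le) (auto simp: fin)
  have le': "(\<Sum>(x, y)\<in>F1 \<union> F2. (\<theta> x y)^4) \<le> (\<Sum>(x, y)\<in>F1. (\<theta> x y)^4) + (\<Sum>(x, y)\<in>F2. (\<theta> x y)^4)"
    by (intro sum_Un_le) (auto simp: fin)
  have "(\<Sum>(x, y)\<in>F. (\<theta> x y)^4) \<le>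
      (324 * b / a)\<^sup>2 * (648 * b * (1 + harm K) / a) + (324 * b / a)\<^sup>2 * (648 * b * (1 + harm K) / a) +
      (256 * b / a / harm K)\<^sup>2 * (324 * b * (1 + harm (nat (sup_norm (y0 - x0)))) / a)"
    by (rule order_trans[OF le add_mono[OF order_trans[OF le' add_mono[OF S1 S2]] S3]])
  also have "\<dots> = 2 * (324 * b / a)\<^sup>2 * (648 * b / a) * (1 + harm K) +
     (256 * b / a)\<^sup>2 * (324 * b / a) * ((1 + harm (nat (sup_norm (y0 - x0)))) / (harm K)\<^sup>2)"
    by (simp add: power_divide power_mult_distrib mult_ac)
  finally show ?thesis .
qed

end

lemma harm_le_ln:
  assumes "1 \<le> n" "real n \<le> t"
  shows "harm n \<le> 1 + ln t"
proof -
  have "harm n - ln (real n) \<le> harm 1 - ln (real 1)"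
    using assms(1) by (intro euler_mascheroni_sequence_decreasing) auto
  moreover have "ln (real n) \<le> ln t" using assms by (subst ln_le_cancel_iff) auto
  ultimately show ?thesis by (simp add: harm_def)
qed

text \<open>The coefficients come from \<open>1 + harm K \<le> 4 * x\<close>, which turns the 2 of
  \<open>quartic_sum_le\<close> into 8, and from \<open>1 + harm N \<le> 3 * L\<close>, where
  \<open>N\<close> is the distance of the poles.\<close>

definition quartic_const :: "real \<Rightarrow> real \<Rightarrow> real" where
  "quartic_const a b = 8 * (324 * b / a)\<^sup>2 * (648 * b / a) + 3 * (256 * b / a)\<^sup>2 * (324 * b / a)"

lemma quartic_const_pos: "0 < a \<Longrightarrow> a \<le> b \<Longrightarrow> 0 < quartic_const a b"
  unfolding quartic_const_def by (intro add_pos_pos mult_pos_pos zero_less_power divide_pos_pos) auto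

lemma quartic_sum_bound:
  assumes cur: "unit_current a b r (0, 0) v \<theta> h" and v: "exp 1 \<le> l1norm v"
    and F: "finite F" "F \<subseteq> Z2_oriented"
  shows "(\<Sum>(x, y)\<in>F. (\<theta> x y)^4) \<le> quartic_const a b * ln (l1norm v) powr (1/3)"
proof -
  interpret unit_current a b r "(0, 0)" v \<theta> h by (rule cur)
  have b: "0 < b" using a_pos a_le_b by simp
  define L where "L = ln (l1norm v)"
  \<comment> \<open>This \<open>K\<close> makes \<open>harm K\<close> comparable to
    \<open>x\<close>, so the two error terms are of order \<open>x\<close> and
    \<open>L / x\<^sup>2\<close>; they balance exactly when \<open>x ^ 3 = L\<close>.\<close>
  define x where "x = L powr (1/3)"
  define K where "K = nat \<lceil>exp x\<rceil>"
  have "0 < l1norm v" using v exp_gt_zero[of "1::real"] by linarith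
  have L: "1 \<le> L" unfolding L_def using v \<open>0 < l1norm v\<close> by (simp add: ln_ge_iff)
  have x: "1 \<le> x" unfolding x_def using L by (simp add: ge_one_powr_ge_zero)
  have x3: "x ^ 3 = L" unfolding x_def using L by (simp add: powr_powr flip: powr_realpow)
  have Kx: "exp x \<le> real K" "real K \<le> exp x + 1"
    unfolding K_def using exp_gt_zero[of x] by linarith+
  have K1: "1 \<le> K" using Kx(1) x one_le_exp_iff[of x] by linarith
  have hK: "x \<le> harm K"
  proof -
    have "x = ln (exp x)" by simp
    also have "\<dots> \<le> ln (real K + 1)" using Kx(1) by (subst ln_le_cancel_iff) (auto intro: add_pos_pos)
    also have "\<dots> \<le> harm K" by (rule ln_le_harm)
    finally show ?thesis .
  qed
  have hK': "1 + harm K \<le> 4 * x"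
  proof -
    have "real K \<le> exp x * exp 1"
    proof -
      have "exp x + 1 \<le> 2 * exp x" using x one_le_exp_iff[of x] by linarith
      also have "\<dots> \<le> exp 1 * exp x" using exp_ge_add_one_self[of "1::real"] by (intro mult_right_mono) auto
      finally show ?thesis using Kx(2) by (simp add: mult.commute)
    qed
    then have "harm K \<le> 1 + ln (exp x * exp 1)" by (rule harm_le_ln[OF K1])
    also have "ln (exp x * exp 1) = x + 1" by (simp flip: exp_add)
    finally show ?thesis using x by linarith
  qed
  have hN: "1 + harm (nat (sup_norm (v - (0, 0)))) \<le> 3 * L"
  proof -
    have "1 \<le> sup_norm v" using neq by (cases v) (auto simp: sup_norm_def)
    moreover have "real (nat (sup_norm v)) \<le> l1norm v"
      by (auto simp: sup_norm_def l1norm_def max_def)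
    ultimately have "harm (nat (sup_norm v)) \<le> 1 + L"
      unfolding L_def by (intro harm_le_ln) auto
    moreover have "v - (0, 0) = v" by (cases v) simp
    ultimately show ?thesis using L by simp
  qed
  have "(\<Sum>(x, y)\<in>F. (\<theta> x y)^4) \<le>
     2 * (324 * b / a)\<^sup>2 * (648 * b / a) * (1 + harm K) +
     (256 * b / a)\<^sup>2 * (324 * b / a) * ((1 + harm (nat (sup_norm (v - (0, 0))))) / (harm K)\<^sup>2)"
    by (rule quartic_sum_le[OF F K1])
  also have "\<dots> \<le> 2 * (324 * b / a)\<^sup>2 * (648 * b / a) * (4 * x) +
     (256 * b / a)\<^sup>2 * (324 * b / a) * (3 * L / x\<^sup>2)"
    using hK hK' hN x a_pos b L
    by (intro add_mono mult_left_mono frac_le power_mono) (auto intro!: mult_nonneg_nonneg)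
  also have "3 * L / x\<^sup>2 = 3 * x" using x unfolding x3[symmetric] by (simp add: power3_eq_cube power2_eq_square)
  finally show ?thesis by (simp add: quartic_const_def x_def L_def algebra_simps)
qed

section \<open>Monotonicity and one-edge perturbations\<close>

text \<open>Rayleigh monotonicity: the optimal flow for \<open>r'\<close> is a competitor for
  \<open>r\<close>.\<close>

lemma eff_res_mono:
  assumes ell: "elliptic a b r" "elliptic a' b' r'" and neq: "x0 \<noteq> y0"
    and le: "\<And>x y. adj x y \<Longrightarrow> r {x, y} \<le> r' {x, y}"
  shows "eff_res r x0 y0 \<le> eff_res r' x0 y0"
proof -
  obtain \<theta> where \<theta>: "unit_flow x0 y0 \<theta>" "finite_energy \<theta>" "real_energy r' \<theta> / 2 = eff_res r' x0 y0"
    using minimizer_exists[OF ell(2) neq] by blast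
  have "real_energy r \<theta> \<le> real_energy r' \<theta>"
    unfolding real_energy_def
  proof (rule infsum_mono)
    fix p assume "p \<in> Z2_oriented"
    then show "(case p of (x, y) \<Rightarrow> r {x, y} * (\<theta> x y)\<^sup>2) \<le> (case p of (x, y) \<Rightarrow> r' {x, y} * (\<theta> x y)\<^sup>2)"
      using le by (auto simp: Z2_oriented_def intro: mult_right_mono)
  qed (use \<theta>(2) in \<open>simp_all add: weighted_summable_iff[OF ell(1)] weighted_summable_iff[OF ell(2)]\<close>)
  with eff_res_le[OF ell(1) \<theta>(1,2)] \<theta>(3) show ?thesis by linarith
qed

text \<open>The optimal flow for \<open>r\<close> is a competitor for \<open>r'\<close>, and passing
  from \<open>r\<close> to \<open>r'\<close> changes its energy at the edge \<open>{u, w}\<close>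
  only.\<close>

lemma eff_res_perturbation:
  assumes ell: "elliptic a b r" "elliptic a b r'"
    and \<theta>: "unit_flow x0 y0 \<theta>" "finite_energy \<theta>" "real_energy r \<theta> / 2 = eff_res r x0 y0"
    and neq: "x0 \<noteq> y0" and adj: "adj u w"
    and eq: "\<And>e. e \<noteq> {u, w} \<Longrightarrow> r' e = r e"
  shows "eff_res r' x0 y0 - eff_res r x0 y0 \<le> (r' {u, w} - r {u, w}) * (\<theta> u w)\<^sup>2"
proof -
  let ?P = "{(u, w), (w, u)}" and ?d = "\<lambda>(x, y). (r' {x, y} - r {x, y}) * (\<theta> x y)\<^sup>2"
  have "\<theta> w u = - \<theta> u w" using \<theta>(1) adj adj_commute unfolding unit_flow_iff[OF neq] by blast
  then have "(?d has_sum (2 * ((r' {u, w} - r {u, w}) * (\<theta> u w)\<^sup>2))) ?P"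
    using adj_imp_neq[OF adj] by (intro has_sum_finiteI) (auto simp: insert_commute)
  moreover have "?P \<subseteq> Z2_oriented" using adj adj_commute[of u w] by (simp add: Z2_oriented_def)
  moreover have "?d p = 0" if "p \<notin> ?P" for p
    using that eq[of "{fst p, snd p}"] by (cases p) (auto simp: doubleton_eq_iff)
  ultimately have "(?d has_sum (2 * ((r' {u, w} - r {u, w}) * (\<theta> u w)\<^sup>2))) Z2_oriented"
    by (subst has_sum_cong_neutral[of ?P Z2_oriented]) auto
  moreover have "((\<lambda>(x, y). r {x, y} * (\<theta> x y)\<^sup>2) has_sum real_energy r \<theta>) Z2_oriented"
    unfolding real_energy_def using \<theta>(2) by (intro has_sum_infsum) (simp add: weighted_summable_iff[OF ell(1)])
  ultimately have "((\<lambda>p. ?d p + (case p of (x, y) \<Rightarrow> r {x, y} * (\<theta> x y)\<^sup>2)) has_sum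
      (2 * ((r' {u, w} - r {u, w}) * (\<theta> u w)\<^sup>2) + real_energy r \<theta>)) Z2_oriented"
    by (rule has_sum_add)
  also have "(\<lambda>p. ?d p + (case p of (x, y) \<Rightarrow> r {x, y} * (\<theta> x y)\<^sup>2)) = (\<lambda>(x, y). r' {x, y} * (\<theta> x y)\<^sup>2)"
    by (auto simp: fun_eq_iff algebra_simps)
  finally have "real_energy r' \<theta> = 2 * ((r' {u, w} - r {u, w}) * (\<theta> u w)\<^sup>2) + real_energy r \<theta>"
    unfolding real_energy_def[of r'] by (rule infsumI)
  with eff_res_le[OF ell(2) \<theta>(1,2)] \<theta>(3) show ?thesis by linarith
qed

text \<open>A configuration is coded by the set of its edges of resistance \<open>a\<close>. Finite
  sets thus code environments that equal \<open>b\<close> off a finite set, and subsets of a finite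
  set code independent fair coins.\<close>

definition two_valued :: "real \<Rightarrow> real \<Rightarrow> vertex set set \<Rightarrow> vertex set \<Rightarrow> real" where
  "two_valued a b A e = (if e \<in> A then a else b)"

lemma elliptic_two_valued: "0 < a \<Longrightarrow> a \<le> b \<Longrightarrow> elliptic a b (two_valued a b A)"
  by (auto simp: elliptic_def two_valued_def)

text \<open>Only removals from \<open>A\<close> occur, that is, resistances raised from
  \<open>a\<close> to \<open>b\<close>. The unit current of the single environment \<open>A\<close>
  therefore bounds all increments, and their squares are dominated by its fourth powers.\<close>

lemma edge_increments_bound:
  assumes ab: "0 < a" "a \<le> b" and v: "exp 1 \<le> l1norm v"
    and A: "finite A" "A \<subseteq> Z2_edges"
  defines "f \<equiv> \<lambda>A. eff_res (two_valued a b A) (0, 0) v"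
  shows "(\<Sum>e\<in>A. (f A - f (A - {e}))\<^sup>2) \<le> (b - a)\<^sup>2 * (quartic_const a b * ln (l1norm v) powr (1/3))"
proof -
  have neq: "(0, 0) \<noteq> v" using v exp_gt_zero[of "1::real"] by (auto simp: l1norm_def)
  note ell = elliptic_two_valued[OF ab]
  obtain \<theta> h where cur: "unit_current a b (two_valued a b A) (0, 0) v \<theta> h"
    and opt: "real_energy (two_valued a b A) \<theta> / 2 = f A"
    using unit_current_exists[OF ell neq] unfolding f_def by blast
  have \<theta>: "unit_flow (0, 0) v \<theta>" "finite_energy \<theta>"
    using cur unfolding unit_current_def finite_energy_def by blast+
  have "\<forall>e\<in>Z2_edges. \<exists>p. adj (fst p) (snd p) \<and> e = {fst p, snd p}" by (force simp: Z2_edges_def)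
  then obtain ori where ori: "\<And>e. e \<in> Z2_edges \<Longrightarrow> adj (fst (ori e)) (snd (ori e)) \<and> e = {fst (ori e), snd (ori e)}"
    by metis
  have incr: "(f A - f (A - {e}))\<^sup>2 \<le> (b - a)\<^sup>2 * (\<theta> (fst (ori e)) (snd (ori e)))^4" if e: "e \<in> A" for e
  proof -
    let ?u = "fst (ori e)" and ?w = "snd (ori e)"
    have uw: "adj ?u ?w" "e = {?u, ?w}" using ori[of e] e A(2) by blast+
    have "f A \<le> f (A - {e})"
      unfolding f_def using ab(2) by (intro eff_res_mono[OF ell ell neq]) (auto simp: two_valued_def)
    moreover have "f (A - {e}) - f A \<le> (two_valued a b (A - {e}) {?u, ?w} - two_valued a b A {?u, ?w}) * (\<theta> ?u ?w)\<^sup>2"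
      unfolding f_def
      by (rule eff_res_perturbation[OF ell ell \<theta> opt[unfolded f_def] neq uw(1)])
        (auto simp: two_valued_def uw(2)[symmetric])
    moreover have "two_valued a b (A - {e}) {?u, ?w} - two_valued a b A {?u, ?w} = b - a"
      using e by (simp add: two_valued_def uw(2)[symmetric])
    ultimately have "(f (A - {e}) - f A)\<^sup>2 \<le> ((b - a) * (\<theta> ?u ?w)\<^sup>2)\<^sup>2"
      by (intro power_mono) auto
    then show ?thesis by (simp add: power_mult_distrib power2_commute flip: power_mult)
  qed
  have inj: "inj_on ori A"
    using ori A(2) by (intro inj_onI) (metis subsetD)
  have "(\<Sum>e\<in>A. (f A - f (A - {e}))\<^sup>2) \<le> (\<Sum>e\<in>A. (b - a)\<^sup>2 * (\<theta> (fst (ori e)) (snd (ori e)))^4)"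
    by (intro sum_mono incr)
  also have "\<dots> = (b - a)\<^sup>2 * (\<Sum>(x, y)\<in>ori ` A. (\<theta> x y)^4)"
    by (simp add: sum.reindex[OF inj] sum_distrib_left case_prod_beta)
  also have "\<dots> \<le> (b - a)\<^sup>2 * (quartic_const a b * ln (l1norm v) powr (1/3))"
  proof (intro mult_left_mono quartic_sum_bound[OF cur v])
    show "ori ` A \<subseteq> Z2_oriented" using ori A(2) by (force simp: Z2_oriented_def)
  qed (use A(1) in auto)
  finally show ?thesis .
qed

section \<open>The Efron--Stein inequality and the variance\<close>

text \<open>Expectation under independent fair coins, one for each element of
  \<open>F\<close>.\<close>

definition subset_mean :: "'a set \<Rightarrow> ('a set \<Rightarrow> real) \<Rightarrow> real" where
  "subset_mean F f = (\<Sum>A\<in>Pow F. f A) / 2 ^ card F"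

lemma subset_mean_cong: "(\<And>A. A \<subseteq> F \<Longrightarrow> f A = g A) \<Longrightarrow> subset_mean F f = subset_mean F g"
  unfolding subset_mean_def by (intro arg_cong2[where f = "(/)"] sum.cong) auto

lemma subset_mean_add: "subset_mean F (\<lambda>A. f A + g A) = subset_mean F f + subset_mean F g"
  by (simp add: subset_mean_def sum.distrib add_divide_distrib)

lemma subset_mean_diff: "subset_mean F (\<lambda>A. f A - g A) = subset_mean F f - subset_mean F g"
  by (simp add: subset_mean_def sum_subtractf diff_divide_distrib)

lemma subset_mean_le:
  assumes "finite F" "\<And>A. A \<subseteq> F \<Longrightarrow> f A \<le> c"
  shows "subset_mean F f \<le> c"
proof -
  have "(\<Sum>A\<in>Pow F. f A) \<le> (\<Sum>A\<in>Pow F. c)" using assms(2) by (intro sum_mono) auto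
  then show ?thesis using assms(1) by (simp add: subset_mean_def card_Pow field_simps)
qed

lemma subset_mean_square_le:
  assumes "finite F"
  shows "(subset_mean F f)\<^sup>2 \<le> subset_mean F (\<lambda>A. (f A)\<^sup>2)"
proof -
  have "(\<Sum>A\<in>Pow F. f A)\<^sup>2 \<le> 2 ^ card F * (\<Sum>A\<in>Pow F. (f A)\<^sup>2)"
    using Cauchy_Schwarz_ineq_sum[of "\<lambda>_. 1" f "Pow F"] assms by (simp add: card_Pow)
  then show ?thesis by (simp add: subset_mean_def power_divide power2_eq_square field_simps)
qed

lemma subset_mean_insert:
  assumes "finite F" "x \<notin> F"
  shows "subset_mean (insert x F) f = (subset_mean F f + subset_mean F (\<lambda>A. f (insert x A))) / 2"
proof -
  have "(\<Sum>A\<in>Pow (insert x F). f A) = (\<Sum>A\<in>Pow F. f A) + (\<Sum>A\<in>insert x ` Pow F. f A)"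
    unfolding Pow_insert using assms by (intro sum.union_disjoint) auto
  also have "(\<Sum>A\<in>insert x ` Pow F. f A) = (\<Sum>A\<in>Pow F. f (insert x A))"
    using assms by (subst sum.reindex) (auto simp: inj_on_def)
  finally show ?thesis using assms by (simp add: subset_mean_def field_simps)
qed

text \<open>The usual fair-coin constant is 1/4 for increments in all directions. Here an element
  contributes only when it belongs to \<open>A\<close>, which happens for half of the sets, so the
  constant becomes 1/2.\<close>

lemma efron_stein:
  assumes "finite F"
  shows "subset_mean F (\<lambda>A. (f A)\<^sup>2) - (subset_mean F f)\<^sup>2 \<le>
    subset_mean F (\<lambda>A. \<Sum>e\<in>A. (f A - f (A - {e}))\<^sup>2) / 2"
  using assms
proof (induction F arbitrary: f)
  case empty
  then show ?case by (simp add: subset_mean_def)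
next
  case (insert x F)
  define g where "g A = f (insert x A)" for A
  define P where "P = subset_mean F (\<lambda>A. (f A)\<^sup>2)"
  define P' where "P' = subset_mean F (\<lambda>A. (g A)\<^sup>2)"
  define m where "m = subset_mean F f"
  define m' where "m' = subset_mean F g"
  define S where "S = subset_mean F (\<lambda>A. \<Sum>e\<in>A. (f A - f (A - {e}))\<^sup>2)"
  define S' where "S' = subset_mean F (\<lambda>A. \<Sum>e\<in>A. (g A - g (A - {e}))\<^sup>2)"
  define D where "D = subset_mean F (\<lambda>A. (g A - f A)\<^sup>2)"
  have IH: "P - m\<^sup>2 \<le> S / 2" "P' - m'\<^sup>2 \<le> S' / 2"
    unfolding P_def m_def S_def P'_def m'_def S'_def by (rule insert.IH)+
  have D: "(m' - m)\<^sup>2 \<le> D"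
    using subset_mean_square_le[OF insert.hyps(1), of "\<lambda>A. g A - f A"]
    by (simp add: m_def m'_def D_def subset_mean_diff)
  have "subset_mean F (\<lambda>A. \<Sum>e\<in>insert x A. (f (insert x A) - f (insert x A - {e}))\<^sup>2) =
      subset_mean F (\<lambda>A. (g A - f A)\<^sup>2 + (\<Sum>e\<in>A. (g A - g (A - {e}))\<^sup>2))"
  proof (rule subset_mean_cong)
    fix A assume A: "A \<subseteq> F"
    then have xA: "x \<notin> A" "finite A" using insert.hyps finite_subset by auto
    have "(\<Sum>e\<in>A. (f (insert x A) - f (insert x A - {e}))\<^sup>2) = (\<Sum>e\<in>A. (g A - g (A - {e}))\<^sup>2)"
      using xA by (intro sum.cong) (auto simp: g_def insert_Diff_if)
    moreover have "insert x A - {x} = A" using xA by auto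
    ultimately show "(\<Sum>e\<in>insert x A. (f (insert x A) - f (insert x A - {e}))\<^sup>2) =
        (g A - f A)\<^sup>2 + (\<Sum>e\<in>A. (g A - g (A - {e}))\<^sup>2)"
      using xA by (simp add: g_def)
  qed
  also have "\<dots> = D + S'" by (simp add: subset_mean_add D_def S'_def)
  finally have rhs: "subset_mean (insert x F) (\<lambda>A. \<Sum>e\<in>A. (f A - f (A - {e}))\<^sup>2) = (S + (D + S')) / 2"
    using insert.hyps by (simp add: subset_mean_insert S_def)
  have lhs: "subset_mean (insert x F) (\<lambda>A. (f A)\<^sup>2) = (P + P') / 2" "subset_mean (insert x F) f = (m + m') / 2"
    using insert.hyps by (simp_all add: subset_mean_insert P_def P'_def m_def m'_def g_def[abs_def])
  \<comment> \<open>Conditioning on membership of \<open>x\<close>: the mean of the two conditional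
    variances plus the variance \<open>(m' - m)\<^sup>2 / 4\<close> of the conditional means. The
    latter is absorbed by the increment \<open>D\<close> in direction \<open>x\<close>.\<close>
  have "(P + P') / 2 - ((m + m') / 2)\<^sup>2 = (P - m\<^sup>2) / 2 + (P' - m'\<^sup>2) / 2 + (m' - m)\<^sup>2 / 4"
    by (simp add: power2_eq_square field_simps)
  also have "\<dots> \<le> (S + (D + S')) / 2 / 2"
  proof -
    have "p / 2 + p' / 2 + d / 4 \<le> (S + (D + S')) / 2 / 2" if "p \<le> S / 2" "p' \<le> S' / 2" "d \<le> D"
      for p p' d using that by (simp add: field_simps)
    from this[OF IH D] show ?thesis .
  qed
  finally show ?case unfolding lhs rhs .
qed

section \<open>The law of the environment and finite cylinders\<close>

lemma space_nu [simp]: "space (nu a b) = UNIV" and sets_nu [simp]: "sets (nu a b) = UNIV"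
  by (simp_all add: nu_def)

lemma prob_space_nu: "prob_space (nu a b)"
  unfolding nu_def by (rule prob_space_measure_pmf)

lemma product_prob_space_nu: "product_prob_space (\<lambda>_. nu a b)"
  using prob_space_nu by (intro product_prob_spaceI)

lemma prob_space_env_law: "prob_space (env_law a b)"
  unfolding env_law_def by (rule prob_space_PiM) (rule prob_space_nu)

lemma measure_nu:
  assumes "a \<noteq> b"
  shows "measure (nu a b) {a} = 1 / 2" "measure (nu a b) (- {a}) = 1 / 2"
proof -
  have "(\<lambda>c. if c then a else b) -` {a} = {True}" "(\<lambda>c. if c then a else b) -` (- {a}) = {False}"
    using assms by (auto split: if_splits)
  then show "measure (nu a b) {a} = 1 / 2" "measure (nu a b) (- {a}) = 1 / 2"
    unfolding nu_def measure_map_pmf by (simp_all add: measure_pmf_single)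
qed

lemma countable_Z2_edges: "countable Z2_edges"
proof -
  have "Z2_edges \<subseteq> (\<lambda>(x, y). {x, y}) ` UNIV" by (auto simp: Z2_edges_def)
  then show ?thesis by (rule countable_subset) simp
qed

lemma AE_env_law: "AE r in env_law a b. \<forall>e\<in>Z2_edges. r e = a \<or> r e = b"
proof (rule AE_ball_countable'[OF _ countable_Z2_edges])
  fix e assume e: "e \<in> Z2_edges"
  have "AE c in nu a b. c = a \<or> c = b" unfolding nu_def by (auto simp: AE_measure_pmf_iff)
  with e show "AE r in env_law a b. r e = a \<or> r e = b"
    unfolding env_law_def by (rule product_prob_space.AE_component[OF product_prob_space_nu])
qed

text \<open>Edges of \<open>F\<close> outside \<open>A\<close> satisfy \<open>r e \<noteq> a\<close>
  instead of \<open>r e = b\<close>, so the cylinders partition the whole space and not merely a set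
  of full measure.\<close>

lemma cylinder_env_law:
  assumes "a \<noteq> b" and F: "finite F" "F \<subseteq> Z2_edges" and A: "A \<subseteq> F"
  defines "C \<equiv> {r \<in> space (env_law a b). {e \<in> F. r e = a} = A}"
  shows "C \<in> sets (env_law a b)" "measure (env_law a b) C = 1 / 2 ^ card F"
proof -
  interpret product_prob_space "\<lambda>_. nu a b" Z2_edges by (rule product_prob_space_nu)
  let ?X = "\<lambda>e. if e \<in> A then {a} else - {a}"
  have "C = {r \<in> space (env_law a b). \<forall>e\<in>F. r e \<in> ?X e}"
    unfolding C_def using A by auto
  also have "\<dots> = emb Z2_edges F (Pi\<^sub>E F ?X)"
    unfolding prod_emb_def env_law_def using F(2)
    by (auto simp: space_PiM Pi_iff PiE_iff extensional_def split: if_splits)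
  finally have C: "C = emb Z2_edges F (Pi\<^sub>E F ?X)" .
  show "C \<in> sets (env_law a b)"
    unfolding C env_law_def using F by (intro sets_PiM_I) auto
  have "measure (env_law a b) C = (\<Prod>e\<in>F. measure (nu a b) (?X e))"
    unfolding C env_law_def using F by (intro measure_PiM_emb) auto
  also have "\<dots> = (\<Prod>e\<in>F. 1 / 2)"
    using measure_nu[OF assms(1)] by (intro prod.cong) auto
  finally show "measure (env_law a b) C = 1 / 2 ^ card F" by (simp add: power_one_over)
qed

lemma integral_env_law_finite:
  assumes "a \<noteq> b" and F: "finite F" "F \<subseteq> Z2_edges"
  shows "(\<lambda>r. g {e \<in> F. r e = a}) \<in> borel_measurable (env_law a b)"
    and "(\<integral>r. g {e \<in> F. r e = a} \<partial>env_law a b) = subset_mean F g"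
proof -
  interpret prob_space "env_law a b" by (rule prob_space_env_law)
  define C where "C A = {r \<in> space (env_law a b). {e \<in> F. r e = a} = A}" for A
  have C: "C A \<in> sets (env_law a b)" "measure (env_law a b) (C A) = 1 / 2 ^ card F" if "A \<subseteq> F" for A
    using cylinder_env_law[OF assms that] by (simp_all add: C_def)
  have eq: "g {e \<in> F. r e = a} = (\<Sum>A\<in>Pow F. g A * indicator (C A) r)" if "r \<in> space (env_law a b)" for r
  proof -
    have "(\<Sum>A\<in>Pow F. g A * indicator (C A) r) = (\<Sum>A\<in>Pow F. if A = {e \<in> F. r e = a} then g A else 0)"
      using that by (intro sum.cong) (auto simp: C_def indicator_def)
    then show ?thesis using F(1) by simp
  qed
  have "(\<lambda>r. \<Sum>A\<in>Pow F. g A * indicator (C A) r) \<in> borel_measurable (env_law a b)"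
    using C by (intro borel_measurable_sum borel_measurable_times borel_measurable_const borel_measurable_indicator) auto
  then show "(\<lambda>r. g {e \<in> F. r e = a}) \<in> borel_measurable (env_law a b)"
    by (subst measurable_cong[OF eq]) auto
  have "(\<integral>r. g {e \<in> F. r e = a} \<partial>env_law a b) = (\<integral>r. (\<Sum>A\<in>Pow F. g A * indicator (C A) r) \<partial>env_law a b)"
    by (rule Bochner_Integration.integral_cong) (auto simp: eq)
  also have "\<dots> = (\<Sum>A\<in>Pow F. g A * measure (env_law a b) (C A))"
    using C by (subst Bochner_Integration.integral_sum) (auto simp: emeasure_eq_measure)
  also have "\<dots> = (\<Sum>A\<in>Pow F. g A * (1 / 2 ^ card F))"
    using C by (intro sum.cong) auto
  also have "\<dots> = subset_mean F g" by (simp add: subset_mean_def sum_divide_distrib)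
  finally show "(\<integral>r. g {e \<in> F. r e = a} \<partial>env_law a b) = subset_mean F g" .
qed

lemma elliptic_if_two_valued:
  assumes "0 < a" "a \<le> b" "\<forall>e\<in>Z2_edges. r e = a \<or> r e = b"
  shows "elliptic a b r"
  unfolding elliptic_def
proof (intro conjI allI impI)
  fix x y assume "adj x y"
  then have "{x, y} \<in> Z2_edges" by (rule Z2_edgesI)
  with assms show "a \<le> r {x, y}" "r {x, y} \<le> b" by fastforce+
qed (rule assms)

text \<open>Setting the edges off \<open>F n\<close> to \<open>b\<close> can only raise the
  resistance. Conversely the optimal flow for \<open>r\<close> is a competitor, and its energy off a
  large finite set is small.\<close>

lemma eff_res_truncation_limit:
  assumes ab: "0 < a" "a \<le> b" and neq: "x0 \<noteq> y0"
    and r: "\<forall>e\<in>Z2_edges. r e = a \<or> r e = b"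
    and F: "\<And>n. F n \<subseteq> Z2_edges" "\<And>e. e \<in> Z2_edges \<Longrightarrow> \<forall>\<^sub>F n in sequentially. e \<in> F n"
  shows "(\<lambda>n. eff_res (two_valued a b {e \<in> F n. r e = a}) x0 y0) \<longlonglongrightarrow> eff_res r x0 y0"
proof -
  define q where "q n = two_valued a b {e \<in> F n. r e = a}" for n
  have ell: "elliptic a b r" by (rule elliptic_if_two_valued[OF ab r])
  have ellq: "elliptic a b (q n)" for n unfolding q_def by (rule elliptic_two_valued[OF ab])
  have lower: "eff_res r x0 y0 \<le> eff_res (q n) x0 y0" for n
  proof (rule eff_res_mono[OF ell ellq neq])
    fix x y assume "adj x y"
    from bspec[OF r Z2_edgesI[OF this]] ab show "r {x, y} \<le> q n {x, y}"
      by (auto simp: q_def two_valued_def)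
  qed
  obtain \<theta> where \<theta>: "unit_flow x0 y0 \<theta>" "finite_energy \<theta>" "real_energy r \<theta> / 2 = eff_res r x0 y0"
    using minimizer_exists[OF ell neq] by blast
  let ?t = "\<lambda>(x, y). (\<theta> x y)\<^sup>2"
  have summ: "?t summable_on Z2_oriented" using \<theta>(2) by (simp add: finite_energy_def)
  have upper: "\<forall>\<^sub>F n in sequentially. eff_res (q n) x0 y0 < eff_res r x0 y0 + \<epsilon>" if "0 < \<epsilon>" for \<epsilon>
  proof -
    \<comment> \<open>Off \<open>G\<close> the flow has squared mass at most
      \<open>\<epsilon> / b\<close> and resistances are at most \<open>b\<close>, so the change of
      environment costs at most \<epsilon> in \<open>real_energy\<close>. Halving this for the
      resistance gives the strict inequality.\<close>
    have "0 < \<epsilon> / b" using that ab by simp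
    from infsum_finite_approximation[OF summ this] obtain G where G: "finite G" "G \<subseteq> Z2_oriented"
      "dist (sum ?t G) (infsum ?t Z2_oriented) \<le> \<epsilon> / b" by blast
    have "\<forall>\<^sub>F n in sequentially. \<forall>p\<in>G. {fst p, snd p} \<in> F n"
    proof (intro eventually_ball_finite ballI F(2) Z2_edgesI G(1))
      fix p assume "p \<in> G"
      with G(2) show "adj (fst p) (snd p)" by (auto simp: Z2_oriented_def)
    qed
    then show ?thesis
    proof eventually_elim
      case (elim n)
      have "(\<Sum>(x, y)\<in>H. q n {x, y} * (\<theta> x y)\<^sup>2) \<le> real_energy r \<theta> + \<epsilon>"
        if H: "finite H" "H \<subseteq> Z2_oriented" for H
      proof -
        have "(\<Sum>(x, y)\<in>H. q n {x, y} * (\<theta> x y)\<^sup>2) \<le>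
            (\<Sum>(x, y)\<in>H. r {x, y} * (\<theta> x y)\<^sup>2 + (if (x, y) \<in> G then 0 else b * (\<theta> x y)\<^sup>2))"
        proof (rule sum_mono, clarify)
          fix x y assume "(x, y) \<in> H"
          then have adj: "adj x y" using H(2) by (auto simp: Z2_oriented_def)
          have rv: "r {x, y} = a \<or> r {x, y} = b" using bspec[OF r Z2_edgesI[OF adj]] .
          show "q n {x, y} * (\<theta> x y)\<^sup>2 \<le> r {x, y} * (\<theta> x y)\<^sup>2 + (if (x, y) \<in> G then 0 else b * (\<theta> x y)\<^sup>2)"
          proof (cases "(x, y) \<in> G")
            case True
            with elim have "{x, y} \<in> F n" by force
            with rv have "q n {x, y} = r {x, y}" by (auto simp: q_def two_valued_def)
            with True show ?thesis by simp
          next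
            case False
            have "q n {x, y} \<le> b" "0 \<le> r {x, y}" using ellipticD[OF ellq[of n] adj] rv ab by auto
            then have "q n {x, y} * (\<theta> x y)\<^sup>2 \<le> b * (\<theta> x y)\<^sup>2" "0 \<le> r {x, y} * (\<theta> x y)\<^sup>2"
              by (auto intro: mult_right_mono)
            with False show ?thesis by simp
          qed
        qed
        also have "\<dots> = (\<Sum>(x, y)\<in>H. r {x, y} * (\<theta> x y)\<^sup>2) + (\<Sum>(x, y)\<in>H. if (x, y) \<in> G then 0 else b * (\<theta> x y)\<^sup>2)"
          by (simp add: sum.distrib case_prod_beta)
        finally have main: "(\<Sum>(x, y)\<in>H. q n {x, y} * (\<theta> x y)\<^sup>2) \<le> \<dots>" .
        have "(\<Sum>(x, y)\<in>H. if (x, y) \<in> G then 0 else b * (\<theta> x y)\<^sup>2) = (\<Sum>p\<in>H - G. b * ?t p)"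
          using H(1) by (intro sum.mono_neutral_cong_right) auto
        also have "\<dots> = b * sum ?t (H - G)" by (simp add: sum_distrib_left)
        also have "\<dots> \<le> b * (\<epsilon> / b)"
        proof (rule mult_left_mono)
          have "sum ?t G + sum ?t (H - G) = sum ?t (G \<union> H)"
            using G(1) H(1) by (subst sum.union_disjoint[symmetric]) auto
          also have "\<dots> \<le> infsum ?t Z2_oriented"
            using G H by (intro finite_sum_le_infsum[OF summ]) auto
          finally show "sum ?t (H - G) \<le> \<epsilon> / b" using G(3) unfolding dist_real_def by linarith
        qed (use ab in simp)
        also have "b * (\<epsilon> / b) = \<epsilon>" using ab by simp
        finally have tail: "(\<Sum>(x, y)\<in>H. if (x, y) \<in> G then 0 else b * (\<theta> x y)\<^sup>2) \<le> \<epsilon>" .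
        show ?thesis
          by (rule order_trans[OF main add_mono[OF partial_sum_le_real_energy[OF ell \<theta>(2) H] tail]])
      qed
      then have "real_energy (q n) \<theta> \<le> real_energy r \<theta> + \<epsilon>"
        by (rule finite_energy_bounded(2)[OF ellq])
      with eff_res_le[OF ellq \<theta>(1,2), of n] \<theta>(3) that show ?case by linarith
    qed
  qed
  show ?thesis
    unfolding q_def[symmetric]
  proof (rule order_tendstoI)
    fix c assume "c < eff_res r x0 y0"
    then show "\<forall>\<^sub>F n in sequentially. c < eff_res (q n) x0 y0"
      using lower by (intro always_eventually allI) (metis less_le_trans)
  next
    fix c assume "eff_res r x0 y0 < c"
    then show "\<forall>\<^sub>F n in sequentially. eff_res (q n) x0 y0 < c" using upper[of "c - eff_res r x0 y0"] by simp
  qed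
qed

text \<open>The Bochner integral of a non-measurable function is 0, so the measurability of the effective
  resistance need not be established.\<close>

lemma variance_of_non_measurable:
  assumes "X \<notin> borel_measurable M" "\<And>x. 0 \<le> X x"
  shows "variance_of M X = 0"
proof -
  have "\<not> integrable M X" using assms(1) by auto
  then have "integral\<^sup>L M X = 0" by (rule not_integrable_integral_eq)
  \<comment> \<open>With the mean equal to 0 the variance integrand is the square of
    \<open>X\<close>, and \<open>X \<ge> 0\<close> is recovered from its square by
    \<open>sqrt\<close>, so the square is not measurable either.\<close>
  moreover have "\<not> integrable M (\<lambda>x. (X x)\<^sup>2)"
  proof
    assume "integrable M (\<lambda>x. (X x)\<^sup>2)"
    from borel_measurable_integrable[OF this]
    have "(\<lambda>x. sqrt ((X x)\<^sup>2)) \<in> borel_measurable M" by (rule measurable_compose) simp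
    with assms show False by simp
  qed
  ultimately show ?thesis by (simp add: variance_of_def not_integrable_integral_eq)
qed

lemma variance_of_AE_const:
  assumes "prob_space M" "X \<in> borel_measurable M" "AE x in M. X x = c"
  shows "variance_of M X = 0"
proof -
  interpret prob_space M by fact
  have "integral\<^sup>L M X = integral\<^sup>L M (\<lambda>_. c)" using assms by (intro integral_cong_AE) auto
  then have "integral\<^sup>L M X = c" by (simp add: prob_space)
  moreover have "integral\<^sup>L M (\<lambda>x. (X x - c)\<^sup>2) = integral\<^sup>L M (\<lambda>_. 0)"
    using assms by (intro integral_cong_AE) auto
  ultimately show ?thesis by (simp add: variance_of_def)
qed

lemma variance_bound:
  assumes ab: "0 < a" "a \<le> b" and v: "exp 1 \<le> l1norm v"
  shows "variance_of (env_law a b) (\<lambda>r. eff_res r (0, 0) v) \<le>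
    (b - a)\<^sup>2 * quartic_const a b / 2 * ln (l1norm v) powr (1/3)"
proof -
  interpret prob_space "env_law a b" by (rule prob_space_env_law)
  let ?M = "env_law a b" and ?X = "\<lambda>r. eff_res r (0, 0) v"
  let ?B = "(b - a)\<^sup>2 * (quartic_const a b * ln (l1norm v) powr (1/3))"
  have neq: "(0, 0) \<noteq> v" using v exp_gt_zero[of "1::real"] by (auto simp: l1norm_def)
  have B0: "0 \<le> ?B" using quartic_const_pos[OF ab] by simp
  \<comment> \<open>For \<open>a = b\<close> the event \<open>r e = a\<close> has probability 1
    instead of 1/2 and the coding by sets fails; the resistance is then almost surely
    constant.\<close>
  consider "?X \<notin> borel_measurable ?M" | "?X \<in> borel_measurable ?M" "a = b"
    | "?X \<in> borel_measurable ?M" "a \<noteq> b" by blast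
  then have "variance_of ?M ?X \<le> ?B / 2"
  proof cases
    case 1
    then have "variance_of ?M ?X = 0" by (rule variance_of_non_measurable) (simp add: eff_res_def)
    with B0 show ?thesis by simp
  next
    case 2
    have "AE r in ?M. ?X r = eff_res (\<lambda>_. a) (0, 0) v"
      using AE_env_law[of a b]
    proof eventually_elim
      case (elim r)
      have eq: "r {x, y} = a" if "adj x y" for x y
        using bspec[OF elim Z2_edgesI[OF that]] \<open>a = b\<close> by simp
      have "elliptic a b r" "elliptic a b (\<lambda>_. a)"
        using elim ab by (auto intro: elliptic_if_two_valued)
      then show ?case by (intro antisym eff_res_mono[OF _ _ neq]) (auto simp: eq)
    qed
    from variance_of_AE_const[OF prob_space_env_law 2(1) this] B0 show ?thesis by simp
  next
    case 3
    define f where "f A = eff_res (two_valued a b A) (0, 0) v" for A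
    define F where "F n = from_nat_into Z2_edges ` {..<n}" for n :: nat
    have "{(0, 0), (1, 0)} \<in> Z2_edges" by (rule Z2_edgesI) (simp add: adj_def)
    then have ne: "Z2_edges \<noteq> {}" by blast
    have F: "finite (F n)" "F n \<subseteq> Z2_edges" for n
      using from_nat_into[OF ne] by (auto simp: F_def)
    have F': "\<forall>\<^sub>F n in sequentially. e \<in> F n" if e: "e \<in> Z2_edges" for e
    proof -
      obtain k where "e = from_nat_into Z2_edges k"
        using from_nat_into_surj[OF countable_Z2_edges e] by metis
      then have "e \<in> F n" if "n \<ge> Suc k" for n using that by (auto simp: F_def)
      then show ?thesis unfolding eventually_sequentially by blast
    qed
    \<comment> \<open>\<open>Y n\<close> depends on finitely many edges, so
      \<open>efron_stein\<close> applies to it with a bound independent of \<open>n\<close>; the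
      variance is reached by dominated convergence of the first two moments.\<close>
    define Y where "Y n r = f {e \<in> F n. r e = a}" for n r
    \<comment> \<open>By monotonicity the environment equal to \<open>b\<close> everywhere has the
      largest resistance and provides the dominating constant.\<close>
    define B where "B = eff_res (two_valued a b {}) (0, 0) v"
    have f: "0 \<le> f A" "f A \<le> B" for A
      unfolding f_def B_def using ab
      by (simp add: eff_res_def)
        (intro eff_res_mono[OF elliptic_two_valued[OF ab] elliptic_two_valued[OF ab] neq],
          simp add: two_valued_def ab(2))
    have lim: "AE r in ?M. (\<lambda>n. Y n r) \<longlonglongrightarrow> ?X r"
      using AE_env_law[of a b]
    proof eventually_elim
      case (elim r)
      show ?case unfolding Y_def f_def by (rule eff_res_truncation_limit[OF ab neq elim F(2) F'])
    qed
    have Y: "Y n \<in> borel_measurable ?M" "integral\<^sup>L ?M (Y n) = subset_mean (F n) f"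
      "integral\<^sup>L ?M (\<lambda>r. (Y n r)\<^sup>2) = subset_mean (F n) (\<lambda>A. (f A)\<^sup>2)" for n
      unfolding Y_def
      by (rule integral_env_law_finite[OF 3(2) F, of f] integral_env_law_finite[OF 3(2) F, of "\<lambda>A. (f A)\<^sup>2"])+
    have Y2: "(\<lambda>r. (Y n r)\<^sup>2) \<in> borel_measurable ?M" for n using Y(1)[of n] by simp
    have lim2: "AE r in ?M. (\<lambda>n. (Y n r)\<^sup>2) \<longlonglongrightarrow> (?X r)\<^sup>2"
      using lim by eventually_elim (rule tendsto_power)
    have bnd: "AE r in ?M. norm (Y n r) \<le> B" "AE r in ?M. norm ((Y n r)\<^sup>2) \<le> B\<^sup>2" for n
      using f by (auto simp: Y_def intro!: power_mono)
    have X2: "(\<lambda>r. (?X r)\<^sup>2) \<in> borel_measurable ?M" using 3(1) by simp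
    have int: "integrable ?M ?X" "integrable ?M (\<lambda>r. (?X r)\<^sup>2)"
      and conv: "(\<lambda>n. integral\<^sup>L ?M (Y n)) \<longlonglongrightarrow> integral\<^sup>L ?M ?X"
        "(\<lambda>n. integral\<^sup>L ?M (\<lambda>r. (Y n r)\<^sup>2)) \<longlonglongrightarrow> integral\<^sup>L ?M (\<lambda>r. (?X r)\<^sup>2)"
      using integrable_dominated_convergence[OF 3(1) Y(1) _ lim bnd(1)]
        integrable_dominated_convergence[OF X2 Y2 _ lim2 bnd(2)]
        integral_dominated_convergence[OF 3(1) Y(1) _ lim bnd(1)]
        integral_dominated_convergence[OF X2 Y2 _ lim2 bnd(2)] by simp_all
    have "variance_of ?M ?X = integral\<^sup>L ?M (\<lambda>r. (?X r)\<^sup>2) - (integral\<^sup>L ?M ?X)\<^sup>2"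
      unfolding variance_of_def by (rule variance_eq[OF int])
    also have "\<dots> \<le> ?B / 2"
    proof (rule LIMSEQ_le_const2)
      show "(\<lambda>n. integral\<^sup>L ?M (\<lambda>r. (Y n r)\<^sup>2) - (integral\<^sup>L ?M (Y n))\<^sup>2) \<longlonglongrightarrow>
          integral\<^sup>L ?M (\<lambda>r. (?X r)\<^sup>2) - (integral\<^sup>L ?M ?X)\<^sup>2"
        by (intro tendsto_diff tendsto_power conv)
      have "integral\<^sup>L ?M (\<lambda>r. (Y n r)\<^sup>2) - (integral\<^sup>L ?M (Y n))\<^sup>2 \<le> ?B / 2" for n
      proof -
        have "subset_mean (F n) (\<lambda>A. \<Sum>e\<in>A. (f A - f (A - {e}))\<^sup>2) \<le> ?B"
          using F[of n] unfolding f_def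
          by (intro subset_mean_le edge_increments_bound[OF ab v]) (auto intro: finite_subset)
        with efron_stein[OF F(1), of n f] show ?thesis unfolding Y by linarith
      qed
      then show "\<exists>N. \<forall>n\<ge>N. integral\<^sup>L ?M (\<lambda>r. (Y n r)\<^sup>2) - (integral\<^sup>L ?M (Y n))\<^sup>2 \<le> ?B / 2" by blast
    qed
    finally show ?thesis .
  qed
  then show ?thesis by (simp add: algebra_simps)
qed

theorem theorem1:
  fixes a b :: real
  assumes "0 < a" and "a \<le> b"
  shows "\<exists>C>0. \<exists>N. \<forall>v::vertex. l1norm v \<ge> N \<longrightarrow>
           variance_of (env_law a b) (\<lambda>r. eff_res r (0, 0) v) \<le> C * (ln (l1norm v)) powr (2/3)"
proof -
  \<comment> \<open>The variance is bounded with exponent 1/3, which is stronger than 2/3 as soon as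
    \<open>ln (l1norm v) \<ge> 1\<close>. The summand 1 keeps \<open>C\<close> positive when
    \<open>a = b\<close>.\<close>
  define C where "C = (b - a)\<^sup>2 * quartic_const a b / 2 + 1"
  have C: "0 < C" unfolding C_def
    using quartic_const_pos[OF assms] by (intro add_nonneg_pos) auto
  have "variance_of (env_law a b) (\<lambda>r. eff_res r (0, 0) v) \<le> C * ln (l1norm v) powr (2/3)"
    if v: "exp 1 \<le> l1norm v" for v
  proof -
    have "0 < l1norm v" using v exp_gt_zero[of "1::real"] by linarith
    with v have L: "1 \<le> ln (l1norm v)" by (simp add: ln_ge_iff)
    have "variance_of (env_law a b) (\<lambda>r. eff_res r (0, 0) v) \<le>
        (b - a)\<^sup>2 * quartic_const a b / 2 * ln (l1norm v) powr (1/3)"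
      by (rule variance_bound[OF assms v])
    also have "\<dots> \<le> C * ln (l1norm v) powr (2/3)"
    proof (rule mult_mono)
      show "ln (l1norm v) powr (1/3) \<le> ln (l1norm v) powr (2/3)" using L by (intro powr_mono) auto
    qed (use C in \<open>auto simp: C_def\<close>)
    finally show ?thesis .
  qed
  with C show ?thesis by blast
qed

end
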